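(* Let $X$ be a complex analytic manifold which is $c_X^i$-hyperbolic (i.e. the integrated Carathéodory pseudodistance $c_X^i$ is a distance on $X$), and let $f:X\to X$ be a holomorphic map such that $f(X)$ is relatively compact in $X$. Then $f$ has a unique fixed point $c\in X$, and the sequence of iterates $(f^n)$ converges, for the compact-open topology, to the constant map $z\mapsto c$. (In particular, the hypothesis that $X$ is $c_X^i$-hyperbolic is satisfied if the Carathéodory pseudodistance $c_X$ is a distance on $X$.)
   Context: Complex manifolds are nonempty and connected. $\Delta\subset\mathbb{C}$ is the open unit disc, and $H(X,\Delta)$ is the set of holomorphic maps $X\to\Delta$. The Poincaré distance on $\Delta$ is $\omega(z,w)=\tanh^{-1}\left|\frac{z-w}{1-\overline{w}z}\right|$. The Carathéodory infinitesimal pseudometric of $X$ is $E_X(x,v)=\sup_{\varphi\in H(X,\Delta)}|\varphi'(x).v|$ for $x\in X$, $v\in T_xX$. The Carathéodory pseudodistance is $c_X(a,b)=\sup_{\varphi\in H(X,\Delta)}\omega(\varphi(a),\varphi(b))$. The integrated Carathéodory pseudodistance $c_X^i(a,b)$ is the infimum, over all piecewise $C^1$ paths $\gamma:[0,1]\to X$ with $\gamma(0)=a$, $\gamma(1)=b$, of the length $\int_0^1E_X(\gamma(t),\gamma'(t))\,dt$. A distance is a finite-valued metric (a pseudodistance that separates points). $f^n$ denotes the $n$-fold composition of $f$ with itself. *)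

theory Defs
  imports "HOL-Analysis.Analysis"
begin

section \<open>Finite-dimensional complex model spaces\<close>

class complex_normed_vector = real_normed_vector +
  fixes scaleC :: "complex \<Rightarrow> 'a \<Rightarrow> 'a" (infixr \<open>*\<^sub>C\<close> 75)
  assumes scaleC_add_right: "a *\<^sub>C (x + y) = a *\<^sub>C x + a *\<^sub>C y"
    and scaleC_add_left: "(a + b) *\<^sub>C x = a *\<^sub>C x + b *\<^sub>C x"
    and scaleC_scaleC: "a *\<^sub>C b *\<^sub>C x = (a * b) *\<^sub>C x"
    and scaleC_of_real: "complex_of_real r *\<^sub>C x = r *\<^sub>R x"
    and norm_scaleC: "norm (a *\<^sub>C x) = cmod a * norm x"

text \<open>
  A type of this class is a copy of \<open>\<complex>\<^sup>n\<close> for some \<open>n \<ge> 0\<close>, with some norm (all norms on it are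
  equivalent). The instances below cover \<open>complex ^ 'n\<close>, that is \<open>n \<ge> 1\<close>, and
  \<open>unit\<close>, that is \<open>n = 0\<close>, which the types \<open>complex ^ 'n\<close> miss.
\<close>

class complex_finite_dim = complex_normed_vector +
  assumes finite_dim: "\<exists>B. finite B \<and> (\<forall>v. \<exists>a. v = (\<Sum>b\<in>B. a b *\<^sub>C b))"

instantiation complex :: complex_finite_dim
begin

definition scaleC_complex :: "complex \<Rightarrow> complex \<Rightarrow> complex" where
  "scaleC_complex a x = a * x"

instance
proof
  show "\<exists>B. finite B \<and> (\<forall>v::complex. \<exists>a. v = (\<Sum>b\<in>B. a b *\<^sub>C b))"
    by (rule exI[of _ "{1}"]) (auto simp: scaleC_complex_def)
qed (auto simp: scaleC_complex_def algebra_simps norm_mult scaleR_conv_of_real)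

end

instantiation vec :: (complex_normed_vector, finite) complex_normed_vector
begin

definition scaleC_vec :: "complex \<Rightarrow> 'a ^ 'b \<Rightarrow> 'a ^ 'b" where
  "scaleC_vec a x = (\<chi> i. a *\<^sub>C (x $ i))"

instance
  by standard
    (simp_all add: scaleC_vec_def vec_eq_iff scaleC_add_right scaleC_add_left scaleC_scaleC
      scaleC_of_real norm_vec_def norm_scaleC L2_set_right_distrib)

end

instance vec :: (complex_finite_dim, finite) complex_finite_dim
proof
  obtain B where B: "finite B" "\<And>v::'a. \<exists>a. v = (\<Sum>b\<in>B. a b *\<^sub>C b)"
    using finite_dim by blast
  have zero: "c *\<^sub>C (0::'a) = 0" for c
    using norm_scaleC[of c "0::'a"] by simp
  define g :: "'b \<times> 'a \<Rightarrow> 'a ^ 'b" where "g = (\<lambda>(i, b). axis i b)"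
  define B' where "B' = g ` (UNIV \<times> (B - {0}))"
  have inj: "inj_on g (UNIV \<times> (B - {0}))"
    by (auto simp: inj_on_def g_def axis_eq_axis)
  show "\<exists>B. finite B \<and> (\<forall>v::'a ^ 'b. \<exists>a. v = (\<Sum>b\<in>B. a b *\<^sub>C b))"
  proof (rule exI[of _ B'], intro conjI allI)
    show "finite B'" using B by (simp add: B'_def)
    fix v :: "'a ^ 'b"
    have "\<forall>i. \<exists>a. v $ i = (\<Sum>b\<in>B. a b *\<^sub>C b)"
      using B(2) by blast
    then obtain a where a: "\<And>i. v $ i = (\<Sum>b\<in>B. a i b *\<^sub>C b)"
      unfolding choice_iff by blast
    define a' where "a' = (\<lambda>w. let p = inv_into (UNIV \<times> (B - {0})) g w in a (fst p) (snd p))"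
    have "(\<Sum>w\<in>B'. a' w *\<^sub>C w) = (\<Sum>p\<in>UNIV \<times> (B - {0}). a' (g p) *\<^sub>C g p)"
      unfolding B'_def by (simp add: sum.reindex[OF inj])
    also have "\<dots> = (\<Sum>p\<in>UNIV \<times> (B - {0}). a (fst p) (snd p) *\<^sub>C g p)"
      by (intro sum.cong) (simp_all add: a'_def inv_into_f_f[OF inj] Let_def)
    also have "\<dots> = v"
    proof (subst vec_eq_iff, intro allI)
      fix j
      have "(\<Sum>p\<in>UNIV \<times> (B - {0}). a (fst p) (snd p) *\<^sub>C g p) $ j
          = (\<Sum>p\<in>UNIV \<times> (B - {0}). if fst p = j then a j (snd p) *\<^sub>C snd p else 0)"
        unfolding sum_component
        by (intro sum.cong refl) (simp add: g_def scaleC_vec_def axis_def zero split: prod.split)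
      also have "\<dots> = (\<Sum>i\<in>UNIV. \<Sum>b\<in>B - {0}. if i = j then a j b *\<^sub>C b else 0)"
        unfolding sum.cartesian_product by (intro sum.cong refl) (simp add: case_prod_unfold)
      also have "\<dots> = (\<Sum>b\<in>B - {0}. a j b *\<^sub>C b)"
        by (subst sum.swap) simp
      also have "\<dots> = v $ j"
        unfolding a using B(1) by (intro sum.mono_neutral_left) (auto simp: zero)
      finally show "(\<Sum>p\<in>UNIV \<times> (B - {0}). a (fst p) (snd p) *\<^sub>C g p) $ j = v $ j" .
    qed
    finally have "v = (\<Sum>w\<in>B'. a' w *\<^sub>C w)" by (rule sym)
    then show "\<exists>a. v = (\<Sum>w\<in>B'. a w *\<^sub>C w)" by (rule exI[of _ a'])
  qed
qed

instantiation unit :: real_normed_vector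
begin

definition zero_unit :: unit where "zero_unit = ()"
definition plus_unit :: "unit \<Rightarrow> unit \<Rightarrow> unit" where "plus_unit x y = ()"
definition minus_unit :: "unit \<Rightarrow> unit \<Rightarrow> unit" where "minus_unit x y = ()"
definition uminus_unit :: "unit \<Rightarrow> unit" where "uminus_unit x = ()"
definition scaleR_unit :: "real \<Rightarrow> unit \<Rightarrow> unit" where "scaleR_unit r x = ()"
definition norm_unit :: "unit \<Rightarrow> real" where "norm_unit x = 0"
definition sgn_unit :: "unit \<Rightarrow> unit" where "sgn_unit x = ()"
definition dist_unit :: "unit \<Rightarrow> unit \<Rightarrow> real" where "dist_unit x y = 0"
definition uniformity_unit :: "(unit \<times> unit) filter" where
  "uniformity_unit = (INF e\<in>{0<..}. principal {(x, y). dist x y < e})"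
definition open_unit :: "unit set \<Rightarrow> bool" where
  "open_unit U \<longleftrightarrow> (\<forall>x\<in>U. \<forall>\<^sub>F (x', y) in uniformity. x' = x \<longrightarrow> y \<in> U)"

instance
  by standard
    (simp_all add: norm_unit_def dist_unit_def sgn_unit_def scaleR_unit_def
      uniformity_unit_def open_unit_def)

end

instantiation unit :: complex_finite_dim
begin

definition scaleC_unit :: "complex \<Rightarrow> unit \<Rightarrow> unit" where "scaleC_unit a x = ()"

instance
  by standard (auto simp: norm_unit_def intro: exI[of _ "{}"])

end

definition holo_on ::
  "('e::complex_normed_vector \<Rightarrow> 'f::complex_normed_vector) \<Rightarrow> 'e set \<Rightarrow> bool" where
  "holo_on f S \<longleftrightarrow>
     (\<forall>z\<in>S. \<exists>D. (f has_derivative D) (at z) \<and> (\<forall>a v. D (a *\<^sub>C v) = a *\<^sub>C D v))"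

lemma holo_on_complex_iff:
  fixes f :: "complex \<Rightarrow> complex"
  assumes "open S"
  shows "holo_on f S \<longleftrightarrow> f holomorphic_on S"
proof -
  have lin: "(\<forall>a v. D (a *\<^sub>C v) = a *\<^sub>C D v) \<longleftrightarrow> (\<exists>d. D = (*) d)" for D :: "complex \<Rightarrow> complex"
  proof
    assume *: "\<forall>a v. D (a *\<^sub>C v) = a *\<^sub>C D v"
    have "D a = D 1 * a" for a
      using *[rule_format, of a 1] unfolding scaleC_complex_def mult_1_right
      by (rule trans) (rule mult.commute)
    then have "D = (*) (D 1)" by (rule ext)
    then show "\<exists>d. D = (*) d" by (rule exI)
  qed (clarsimp simp: scaleC_complex_def mult.left_commute)
  have "(\<exists>D. (f has_derivative D) (at z) \<and> (\<forall>a v. D (a *\<^sub>C v) = a *\<^sub>C D v))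
      \<longleftrightarrow> f field_differentiable at z" for z
    unfolding lin field_differentiable_def has_field_derivative_def by auto
  then have "holo_on f S \<longleftrightarrow> (\<forall>z\<in>S. f field_differentiable at z)"
    unfolding holo_on_def by (simp only:)
  moreover have "at z within S = at z" if "z \<in> S" for z
    using that assms by (rule at_within_open)
  ultimately show ?thesis
    by (simp add: holomorphic_on_def)
qed


section \<open>Complex manifolds and holomorphic maps\<close>

text \<open>
  A chart is a pair \<open>(U, \<kappa>)\<close> of a set and a map on it; values of \<open>\<kappa>\<close> off \<open>U\<close> are irrelevant, and
  \<open>inv_into U \<kappa>\<close> is the inverse chart. The atlas need not be maximal: compatible atlases give
  the same notions below.
\<close>

type_synonym ('a, 'e) chart = "'a set \<times> ('a \<Rightarrow> 'e)"

record ('a, 'e) cmanifold =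
  mtop :: "'a topology"
  atlas :: "('a, 'e) chart set"

definition points :: "('a, 'e) cmanifold \<Rightarrow> 'a set" where
  "points X = topspace (mtop X)"

definition is_chart :: "'a topology \<Rightarrow> ('a, 'e::complex_finite_dim) chart \<Rightarrow> bool" where
  "is_chart T = (\<lambda>(U, \<kappa>). openin T U \<and> open (\<kappa> ` U) \<and>
     homeomorphic_map (subtopology T U) (top_of_set (\<kappa> ` U)) \<kappa>)"

definition complex_manifold :: "('a, 'e::complex_finite_dim) cmanifold \<Rightarrow> bool" where
  "complex_manifold X \<longleftrightarrow>
     points X \<noteq> {} \<and> connected_space (mtop X) \<and> Hausdorff_space (mtop X) \<and>
     (\<forall>c\<in>atlas X. is_chart (mtop X) c) \<and>
     points X = (\<Union>c\<in>atlas X. fst c) \<and>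
     (\<forall>(U, \<kappa>)\<in>atlas X. \<forall>(V, \<psi>)\<in>atlas X. holo_on (\<psi> \<circ> inv_into U \<kappa>) (\<kappa> ` (U \<inter> V)))"

definition holomorphic_map ::
  "('a, 'e::complex_finite_dim) cmanifold \<Rightarrow> ('b, 'f::complex_finite_dim) cmanifold
    \<Rightarrow> ('a \<Rightarrow> 'b) \<Rightarrow> bool" where
  "holomorphic_map X Y f \<longleftrightarrow>
     continuous_map (mtop X) (mtop Y) f \<and>
     (\<forall>(U, \<kappa>)\<in>atlas X. \<forall>(V, \<psi>)\<in>atlas Y.
        holo_on (\<psi> \<circ> f \<circ> inv_into U \<kappa>) (\<kappa> ` {x \<in> U. f x \<in> V}))"

definition unit_disc :: "(complex, complex) cmanifold" where
  "unit_disc = \<lparr>mtop = top_of_set (ball 0 1), atlas = {(ball 0 1, \<lambda>z. z)}\<rparr>"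

text \<open>Values of \<open>\<phi>\<close> off \<open>points X\<close> are unconstrained, and do not affect the suprema below.\<close>

definition disc_maps :: "('a, 'e::complex_finite_dim) cmanifold \<Rightarrow> ('a \<Rightarrow> complex) set" where
  "disc_maps X = {\<phi>. holomorphic_map X unit_disc \<phi>}"


section \<open>Tangent vectors\<close>

text \<open>
  A tangent vector at \<open>x\<close> is the family of its coordinate vectors in all charts around \<open>x\<close>, which
  transform by the derivatives of the chart changes (and, for uniqueness, vanish at all other charts).
\<close>

type_synonym ('a, 'e) tangent = "('a, 'e) chart \<Rightarrow> 'e"

definition charts_at :: "('a, 'e) cmanifold \<Rightarrow> 'a \<Rightarrow> ('a, 'e) chart set" where
  "charts_at X x = {c \<in> atlas X. x \<in> fst c}"

definition tangent_space ::
  "('a, 'e::complex_finite_dim) cmanifold \<Rightarrow> 'a \<Rightarrow> ('a, 'e) tangent set" where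
  "tangent_space X x =
     {v. (\<forall>c\<in>charts_at X x. \<forall>c'\<in>charts_at X x.
            v c' = frechet_derivative (snd c' \<circ> inv_into (fst c) (snd c)) (at (snd c x)) (v c)) \<and>
         (\<forall>c. c \<notin> charts_at X x \<longrightarrow> v c = 0)}"

text \<open>
  The derivative \<open>\<phi>'(x).v\<close> of a complex-valued function; for a tangent vector \<open>v\<close> it does not
  depend on the chart.
\<close>

definition mderiv ::
  "('a, 'e::complex_finite_dim) cmanifold \<Rightarrow> ('a \<Rightarrow> complex) \<Rightarrow> 'a \<Rightarrow> ('a, 'e) tangent \<Rightarrow> complex"
  where
  "mderiv X \<phi> x v =
     (let c = (SOME c. c \<in> charts_at X x)
      in frechet_derivative (\<phi> \<circ> inv_into (fst c) (snd c)) (at (snd c x)) (v c))"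

definition velocity ::
  "('a, 'e::complex_finite_dim) cmanifold \<Rightarrow> (real \<Rightarrow> 'a) \<Rightarrow> real \<Rightarrow> ('a, 'e) tangent" where
  "velocity X \<gamma> t =
     (\<lambda>c. if c \<in> charts_at X (\<gamma> t)
          then vector_derivative (snd c \<circ> \<gamma>) (at t within {0..1}) else 0)"


lemma charts_atD:
  assumes "complex_manifold X" "c \<in> charts_at X x"
  shows "inv_into (fst c) (snd c) (snd c x) = x"
    and "openin (mtop X) W \<Longrightarrow> open (snd c ` (fst c \<inter> W))"
    and "inj_on (snd c) (fst c)"
    and "openin (mtop X) (fst c)"
proof -
  have "c \<in> atlas X" and x: "x \<in> fst c"
    using assms(2) by (simp_all add: charts_at_def)
  moreover have "\<forall>c\<in>atlas X. is_chart (mtop X) c"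
    using assms(1) unfolding complex_manifold_def by (elim conjE)
  ultimately have "is_chart (mtop X) c" by (simp only:)
  then have U: "openin (mtop X) (fst c)" and O: "open (snd c ` fst c)"
    and h: "homeomorphic_map (subtopology (mtop X) (fst c)) (top_of_set (snd c ` fst c)) (snd c)"
    by (simp_all add: is_chart_def case_prod_unfold)
  have ts: "topspace (subtopology (mtop X) (fst c)) = fst c"
    using openin_subset[OF U] by (simp add: inf.absorb2)
  show inj: "inj_on (snd c) (fst c)"
    using homeomorphic_imp_injective_map[OF h] unfolding ts .
  show "inv_into (fst c) (snd c) (snd c x) = x"
    using inj x by (rule inv_into_f_f)
  show "openin (mtop X) (fst c)" by (rule U)
  assume W: "openin (mtop X) W"
  have "openin (subtopology (mtop X) (fst c)) (fst c \<inter> W)"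
    using W by (auto simp: openin_subtopology)
  then have "openin (top_of_set (snd c ` fst c)) (snd c ` (fst c \<inter> W))"
    using homeomorphic_imp_open_map[OF h] by (simp add: open_map_def)
  then show "open (snd c ` (fst c \<inter> W))"
    using O openin_open_trans by blast
qed

lemma holo_onD: "holo_on f S \<Longrightarrow> z \<in> S \<Longrightarrow> f differentiable (at z)"
  unfolding holo_on_def differentiable_def by blast

lemma transition_differentiable:
  assumes "complex_manifold X" "c \<in> charts_at X x" "c' \<in> charts_at X x"
  shows "(snd c' \<circ> inv_into (fst c) (snd c)) differentiable (at (snd c x))"
proof -
  have "c \<in> atlas X" "c' \<in> atlas X" and x: "x \<in> fst c \<inter> fst c'"
    using assms(2,3) by (simp_all add: charts_at_def)
  moreover have "\<forall>c\<in>atlas X. \<forall>c'\<in>atlas X.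
      holo_on (snd c' \<circ> inv_into (fst c) (snd c)) (snd c ` (fst c \<inter> fst c'))"
    using assms(1) unfolding complex_manifold_def case_prod_unfold by (elim conjE)
  ultimately have "holo_on (snd c' \<circ> inv_into (fst c) (snd c)) (snd c ` (fst c \<inter> fst c'))"
    by (simp only:)
  then show ?thesis using x by (rule holo_onD[OF _ imageI])
qed

lemma velocity_in_tangent_space:
  assumes X: "complex_manifold X" and \<gamma>: "pathin (mtop X) \<gamma>"
    and t: "t \<in> {0..1}"
    and d: "\<And>c. c \<in> charts_at X (\<gamma> t) \<Longrightarrow> (snd c \<circ> \<gamma>) differentiable (at t within {0..1})"
  shows "velocity X \<gamma> t \<in> tangent_space X (\<gamma> t)"
proof -
  have "vector_derivative (snd c' \<circ> \<gamma>) (at t within {0..1})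
     = frechet_derivative (snd c' \<circ> inv_into (fst c) (snd c)) (at (snd c (\<gamma> t)))
         (vector_derivative (snd c \<circ> \<gamma>) (at t within {0..1}))"
    if c: "c \<in> charts_at X (\<gamma> t)" and c': "c' \<in> charts_at X (\<gamma> t)" for c c'
  proof -
    let ?\<tau> = "snd c' \<circ> inv_into (fst c) (snd c)"
    let ?D = "frechet_derivative ?\<tau> (at (snd c (\<gamma> t)))"
    let ?w = "vector_derivative (snd c \<circ> \<gamma>) (at t within {0..1})"
    have D: "(?\<tau> has_derivative ?D) (at ((snd c \<circ> \<gamma>) t))"
      using transition_differentiable[OF X c c'] by (simp add: frechet_derivative_works)
    have w: "((snd c \<circ> \<gamma>) has_vector_derivative ?w) (at t within {0..1})"
      using d[OF c] by (simp add: vector_derivative_works)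
    have "(?\<tau> \<circ> (snd c \<circ> \<gamma>) has_derivative ?D \<circ> (\<lambda>h. h *\<^sub>R ?w)) (at t within {0..1})"
      using w unfolding has_vector_derivative_def
      by (rule diff_chain_within) (rule has_derivative_at_withinI[OF D])
    moreover have "?D \<circ> (\<lambda>h. h *\<^sub>R ?w) = (\<lambda>h. h *\<^sub>R ?D ?w)"
      using has_derivative_linear[OF D] by (auto simp: linear_scale)
    ultimately have 1: "(?\<tau> \<circ> (snd c \<circ> \<gamma>) has_vector_derivative ?D ?w) (at t within {0..1})"
      by (simp only: has_vector_derivative_def)
    have op: "openin (top_of_set {0..1}) {s \<in> {0..1}. \<gamma> s \<in> fst c}"
      using openin_continuous_map_preimage[of "top_of_set {0..1}" "mtop X" \<gamma> "fst c"] \<gamma>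
        charts_atD(4)[OF X c] by (simp add: pathin_def)
    then obtain T where T: "open T" "{s \<in> {0..1}. \<gamma> s \<in> fst c} = {0..1} \<inter> T"
      by (auto simp: openin_open)
    have tT: "t \<in> T" using T(2) t c by (auto simp: charts_at_def)
    obtain e where e: "e > 0" "\<And>s. dist s t < e \<Longrightarrow> s \<in> T"
      using T(1) tT by (auto simp: open_dist)
    have 2: "(snd c' \<circ> \<gamma> has_vector_derivative ?D ?w) (at t within {0..1})"
    proof (rule has_vector_derivative_transform_within[OF 1 e(1) t])
      fix s :: real assume s: "s \<in> {0..1}" "dist s t < e"
      then have "\<gamma> s \<in> fst c" using e(2) T(2) by blast
      then show "(?\<tau> \<circ> (snd c \<circ> \<gamma>)) s = (snd c' \<circ> \<gamma>) s"
        using charts_atD(3)[OF X c] by (simp add: inv_into_f_f)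
    qed
    have "at t within {0..1} \<noteq> bot"
      using trivial_limit_within[of t "{0..1}"] islimpt_Icc[of 0 1 t] t by simp
    then show ?thesis
      using 2 by (rule vector_derivative_within)
  qed
  note * = this
  show ?thesis
    unfolding tangent_space_def
  proof (intro CollectI conjI ballI allI impI)
    fix c c' assume c: "c \<in> charts_at X (\<gamma> t)" "c' \<in> charts_at X (\<gamma> t)"
    show "velocity X \<gamma> t c' =
        frechet_derivative (snd c' \<circ> inv_into (fst c) (snd c)) (at (snd c (\<gamma> t))) (velocity X \<gamma> t c)"
      unfolding velocity_def if_P[OF c(1)] if_P[OF c(2)] by (rule *[OF c])
  qed (simp add: velocity_def)
qed

lemma disc_maps_differentiable:
  assumes "complex_manifold X" "c \<in> charts_at X x" "\<phi> \<in> disc_maps X"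
  shows "(\<phi> \<circ> inv_into (fst c) (snd c)) differentiable (at (snd c x))"
proof -
  have hol: "holomorphic_map X unit_disc \<phi>" and c: "c \<in> atlas X"
    using assms(2,3) by (simp_all add: disc_maps_def charts_at_def)
  then have \<phi>: "continuous_map (mtop X) (top_of_set (ball 0 1)) \<phi>"
    by (simp add: holomorphic_map_def unit_disc_def)
  have "\<forall>c\<in>atlas X. \<forall>c'\<in>atlas unit_disc.
      holo_on (snd c' \<circ> \<phi> \<circ> inv_into (fst c) (snd c)) (snd c ` {x \<in> fst c. \<phi> x \<in> fst c'})"
    using hol unfolding holomorphic_map_def case_prod_unfold by (elim conjE)
  from this[rule_format, OF c, of "(ball 0 1, \<lambda>z. z)"]
  have h: "holo_on ((\<lambda>z. z) \<circ> \<phi> \<circ> inv_into (fst c) (snd c)) (snd c ` {x \<in> fst c. \<phi> x \<in> ball 0 1})"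
    by (simp only: unit_disc_def cmanifold.simps singletonI fst_conv snd_conv simp_thms)
  have xU: "x \<in> fst c"
    using assms(2) by (simp add: charts_at_def)
  then have "x \<in> topspace (mtop X)"
    using openin_subset[OF charts_atD(4)[OF assms(1,2)]] by blast
  then have "x \<in> {x \<in> fst c. \<phi> x \<in> ball 0 1}"
    using continuous_map_image_subset_topspace[OF \<phi>] xU by auto
  from holo_onD[OF h imageI[OF this]] show ?thesis
    by (simp only: comp_def)
qed

lemma mderiv_chart:
  assumes X: "complex_manifold X" and \<phi>: "\<phi> \<in> disc_maps X"
    and v: "v \<in> tangent_space X x" and c: "c \<in> charts_at X x"
  shows "mderiv X \<phi> x v =
    frechet_derivative (\<phi> \<circ> inv_into (fst c) (snd c)) (at (snd c x)) (v c)"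
proof -
  define c' where "c' = (SOME c. c \<in> charts_at X x)"
  have c': "c' \<in> charts_at X x" unfolding c'_def using c by (rule someI)
  let ?\<tau> = "snd c' \<circ> inv_into (fst c) (snd c)"
  let ?F = "\<lambda>c. \<phi> \<circ> inv_into (fst c) (snd c)"
  let ?W = "snd c ` (fst c \<inter> fst c')"
  have x: "x \<in> fst c \<inter> fst c'" using c c' by (auto simp: charts_at_def)
  have "(?F c' has_derivative frechet_derivative (?F c') (at (snd c' x))) (at (?\<tau> (snd c x)))"
    using disc_maps_differentiable[OF X c' \<phi>] charts_atD(1)[OF X c]
    by (simp add: frechet_derivative_works)
  moreover have "(?\<tau> has_derivative frechet_derivative ?\<tau> (at (snd c x))) (at (snd c x))"
    using transition_differentiable[OF X c c'] by (simp add: frechet_derivative_works)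
  ultimately have "(?F c' \<circ> ?\<tau> has_derivative
      frechet_derivative (?F c') (at (snd c' x)) \<circ> frechet_derivative ?\<tau> (at (snd c x))) (at (snd c x))"
    by (intro diff_chain_at)
  then have "(?F c has_derivative
      frechet_derivative (?F c') (at (snd c' x)) \<circ> frechet_derivative ?\<tau> (at (snd c x))) (at (snd c x))"
  proof (rule has_derivative_transform_within_open)
    show "open ?W" using charts_atD(2)[OF X c charts_atD(4)[OF X c']] .
    show "snd c x \<in> ?W" using x by blast
    fix z assume "z \<in> ?W"
    then show "(?F c' \<circ> ?\<tau>) z = ?F c z"
      using charts_atD(3)[OF X c] charts_atD(3)[OF X c'] by (auto simp: inv_into_f_f)
  qed
  from frechet_derivative_at[OF this]
  have "frechet_derivative (?F c) (at (snd c x)) (v c)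
      = frechet_derivative (?F c') (at (snd c' x)) (frechet_derivative ?\<tau> (at (snd c x)) (v c))"
    unfolding comp_def by (rule fun_cong[OF sym])
  also have "frechet_derivative ?\<tau> (at (snd c x)) (v c) = v c'"
    using v c c' unfolding tangent_space_def mem_Collect_eq by (elim conjE) (drule (1) bspec, drule (1) bspec, erule sym)
  finally show ?thesis
    unfolding mderiv_def Let_def c'_def[symmetric] by (rule sym)
qed


section \<open>Paths\<close>

text \<open>At the end points of \<open>{a..b}\<close> the derivatives are one-sided.\<close>

definition C1_on ::
  "('a, 'e::complex_finite_dim) cmanifold \<Rightarrow> real \<Rightarrow> real \<Rightarrow> (real \<Rightarrow> 'a) \<Rightarrow> bool" where
  "C1_on X a b \<gamma> \<longleftrightarrow>
     (\<forall>(U, \<kappa>)\<in>atlas X. \<exists>D. continuous_on {s \<in> {a..b}. \<gamma> s \<in> U} D \<and>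
        (\<forall>s\<in>{a..b}. \<gamma> s \<in> U \<longrightarrow> ((\<kappa> \<circ> \<gamma>) has_vector_derivative D s) (at s within {a..b})))"

definition piecewise_C1_path ::
  "('a, 'e::complex_finite_dim) cmanifold \<Rightarrow> 'a \<Rightarrow> 'a \<Rightarrow> (real \<Rightarrow> 'a) \<Rightarrow> bool" where
  "piecewise_C1_path X a b \<gamma> \<longleftrightarrow>
     pathin (mtop X) \<gamma> \<and> \<gamma> 0 = a \<and> \<gamma> 1 = b \<and>
     (\<exists>(N::nat) p. p 0 = 0 \<and> p N = 1 \<and> (\<forall>i<N. p i < p (Suc i) \<and> C1_on X (p i) (p (Suc i)) \<gamma>))"


section \<open>Caratheodory pseudometrics\<close>

definition poincare_dist :: "complex \<Rightarrow> complex \<Rightarrow> real" where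
  "poincare_dist z w = artanh (cmod ((z - w) / (1 - cnj w * z)))"

definition carath_inf ::
  "('a, 'e::complex_finite_dim) cmanifold \<Rightarrow> 'a \<Rightarrow> ('a, 'e) tangent \<Rightarrow> ennreal" where
  "carath_inf X x v = (SUP \<phi>\<in>disc_maps X. ennreal (cmod (mderiv X \<phi> x v)))"

definition carath :: "('a, 'e::complex_finite_dim) cmanifold \<Rightarrow> 'a \<Rightarrow> 'a \<Rightarrow> ennreal" where
  "carath X a b = (SUP \<phi>\<in>disc_maps X. ennreal (poincare_dist (\<phi> a) (\<phi> b)))"

text \<open>\<open>velocity X \<gamma> t\<close> is meaningless at the finitely many corners, a null set for the integral.\<close>

definition carath_length ::
  "('a, 'e::complex_finite_dim) cmanifold \<Rightarrow> (real \<Rightarrow> 'a) \<Rightarrow> ennreal" where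
  "carath_length X \<gamma> = (\<integral>\<^sup>+t\<in>{0..1}. carath_inf X (\<gamma> t) (velocity X \<gamma> t) \<partial>lborel)"

definition int_carath :: "('a, 'e::complex_finite_dim) cmanifold \<Rightarrow> 'a \<Rightarrow> 'a \<Rightarrow> ennreal" where
  "int_carath X a b = (INF \<gamma>\<in>{\<gamma>. piecewise_C1_path X a b \<gamma>}. carath_length X \<gamma>)"

definition is_distance_on :: "'a set \<Rightarrow> ('a \<Rightarrow> 'a \<Rightarrow> ennreal) \<Rightarrow> bool" where
  "is_distance_on S d \<longleftrightarrow>
     (\<forall>x\<in>S. \<forall>y\<in>S. d x y < \<infinity> \<and> (d x y = 0 \<longleftrightarrow> x = y) \<and> d x y = d y x \<and>
        (\<forall>z\<in>S. d x z \<le> d x y + d y z))"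

definition int_carath_hyperbolic :: "('a, 'e::complex_finite_dim) cmanifold \<Rightarrow> bool" where
  "int_carath_hyperbolic X \<longleftrightarrow> is_distance_on (points X) (int_carath X)"


section \<open>Relative compactness and the compact-open topology\<close>

definition relatively_compact_in :: "'a topology \<Rightarrow> 'a set \<Rightarrow> bool" where
  "relatively_compact_in T S \<longleftrightarrow> S \<subseteq> topspace T \<and> compactin T (T closure_of S)"

definition compact_open_topology :: "'a topology \<Rightarrow> 'b topology \<Rightarrow> ('a \<Rightarrow> 'b) topology" where
  "compact_open_topology S T =
     topology_generated_by
       {{g. continuous_map S T g \<and> g ` K \<subseteq> V} |K V. compactin S K \<and> openin T V}"

end

theory Submission
  imports Defs "HOL-Complex_Analysis.Cauchy_Integral_Formula" "HOL-Complex_Analysis.Riemann_Mapping"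
begin

text \<open>
  Let \<open>K\<close> be the closure of \<open>f(X)\<close>. The distance \<open>c\<^sub>X\<^sup>i\<close> is continuous, hence bounded on the compact
  set \<open>K\<close>, and it controls \<open>- ln (1 - |\<phi>|\<^sup>2)\<close> for every holomorphic \<open>\<phi> : X \<rightarrow> \<Delta>\<close>. So there is
  \<open>k < 1\<close> such that \<open>|\<phi> \<circ> f| < k\<close> on \<open>X\<close> whenever \<open>\<phi>\<close> vanishes at some point of \<open>f(X)\<close>; then
  \<open>\<phi> \<circ> f / k\<close> is again a map into the disc. Since a Moebius transformation normalises any \<open>\<phi>\<close> to
  vanish at \<open>f(x)\<close> without decreasing \<open>|\<phi>'(f(x)).w|\<close>, this gives \<open>E\<^sub>X(f(x), f'(x).v) \<le> k E\<^sub>X(x, v)\<close>,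
  as in the theorem of Earle and Hamilton. Therefore \<open>f\<close> contracts \<open>c\<^sub>X\<^sup>i\<close> by the factor \<open>k\<close>; a point
  of \<open>K\<close> that minimises \<open>c\<^sub>X\<^sup>i(x, f(x))\<close> is fixed, and all orbits converge to it uniformly.
\<close>

section \<open>Holomorphic maps between finite-dimensional spaces\<close>

text \<open>On a bounded domain of a normed space, the Earle-Hamilton argument perturbs the map
  itself, adding a small multiple of \<open>f(z) - f(x)\<close>. A manifold has no such addition, so
  the room left by relative compactness is used in the target disc instead, by rescaling. The
  distance is not known to be complete, so Banach's fixed point theorem is not at hand; compactness
  of \<open>K\<close> replaces completeness. Compactness also turns convergence in the distance into
  convergence in the topology of \<open>X\<close>: a closed part of \<open>K\<close> that misses the
  fixed point has positive distance from it. Both uses of compactness rest on the continuity of the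
  distance in the manifold topology. This comes from Cauchy estimates in charts, which bound all
  disc maps at once. Since the model space carries an abstract norm and holomorphy means mere
  complex differentiability, continuous coordinates and continuity of derivatives have to be
  established beforehand.\<close>

interpretation cvs: vector_space "scaleC :: complex \<Rightarrow> 'a::complex_normed_vector \<Rightarrow> 'a"
  by unfold_locales
    (simp_all add: scaleC_add_right scaleC_add_left scaleC_scaleC scaleC_of_real[of 1, simplified])

lemma bounded_linear_scaleC_left: "bounded_linear (\<lambda>a. a *\<^sub>C (v::'a::complex_normed_vector))"
proof
  show "\<exists>K. \<forall>a. norm (a *\<^sub>C v) \<le> norm a * K"
    by (intro exI[of _ "norm v"]) (simp add: norm_scaleC)
  show "(r *\<^sub>R a) *\<^sub>C v = r *\<^sub>R a *\<^sub>C v" for r a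
    by (simp add: scaleR_conv_of_real scaleC_of_real flip: scaleC_scaleC)
qed (simp add: scaleC_add_left)

text \<open>A maximal independent subset of the given spanning set supplies the coordinates. Their
  continuity is the real content, since the norm is not tied to any basis. It lets vector-valued
  holomorphic maps be handled one scalar component at a time.\<close>

lemma complex_finite_dim_coordinates:
  obtains B and c :: "'a \<Rightarrow> 'a::complex_finite_dim \<Rightarrow> complex"
  where "finite B" "\<And>b. bounded_linear (c b)" "\<And>b a v. c b (a *\<^sub>C v) = a * c b v"
    "\<And>v. v = (\<Sum>b\<in>B. c b v *\<^sub>C b)"
proof -
  obtain B0 :: "'a set" where B0: "finite B0" "\<And>v. \<exists>a. v = (\<Sum>b\<in>B0. a b *\<^sub>C b)"
    using finite_dim by blast
  have "v \<in> cvs.span B0" for v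
    using B0(2)[of v] by (auto intro!: cvs.span_sum cvs.span_scale intro: cvs.span_base)
  moreover obtain B where B: "B \<subseteq> B0" "cvs.independent B" "B0 \<subseteq> cvs.span B"
    using cvs.maximal_independent_subset[of B0] by blast
  ultimately have span: "v \<in> cvs.span B" for v
    using cvs.span_mono[OF B(3)] cvs.span_span by blast
  have fin: "finite B" using B(1) B0(1) finite_subset by blast
  define c where "c = (\<lambda>b v. cvs.representation B v b)"
  have rep: "v = (\<Sum>b\<in>B. c b v *\<^sub>C b)" for v
    unfolding c_def using cvs.sum_representation_eq[OF B(2) span fin order_refl] by simp
  have c_add: "c b (v + w) = c b v + c b w" for b v w
    unfolding c_def by (rule cvs.representation_add[OF B(2) span span, THEN fun_cong])
  have c_scale: "c b (a *\<^sub>C v) = a * c b v" for b a v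
    unfolding c_def by (rule cvs.representation_scale[OF B(2) span, THEN fun_cong])
  have c_sum: "c b (\<Sum>b'\<in>B. l b' *\<^sub>C b') = l b" if "b \<in> B" for b l
  proof -
    have "c b (sum f S) = (\<Sum>s\<in>S. c b (f s))" if "finite S" for f and S :: "'a set"
      using that c_add c_scale[of b 0 0] by (induction rule: finite_induct) simp_all
    then show ?thesis
      using fin that cvs.representation_basis[OF B(2)]
      by (simp add: c_scale) (simp add: c_def if_distrib[of "(*) _"] cong: if_cong)
  qed
  define N where "N = (\<lambda>v. \<Sum>b\<in>B. cmod (c b v))"
  \<comment> \<open>Equivalence of norms, by compactness: otherwise there are vectors with
    \<open>N = 1\<close> and norm tending to 0. Along a subsequence their coordinates converge to
    those of some \<open>l\<close>; the norm limit forces \<open>l = 0\<close>, whereas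
    \<open>N\<close> passes to the limit and stays 1.\<close>
  have "\<exists>C. \<forall>v. N v \<le> C * norm v"
  proof (rule ccontr)
    assume "\<nexists>C. \<forall>v. N v \<le> C * norm v"
    then have "\<forall>n::nat. \<exists>v. N v > Suc n * norm v" by (metis not_le)
    then obtain v where v: "\<And>n::nat. N (v n) > Suc n * norm (v n)" by metis
    have Npos: "N (v n) > 0" for n
      using v[of n] by (smt (verit) mult_nonneg_nonneg norm_ge_zero of_nat_0_le_iff)
    define w where "w = (\<lambda>n. complex_of_real (1 / N (v n)) *\<^sub>C v n)"
    have Nw: "N (w n) = 1" for n
    proof -
      have "cmod (c b (w n)) = cmod (c b (v n)) / N (v n)" for b
        unfolding w_def c_scale using Npos[of n] by (simp add: norm_mult norm_divide)
      then have "N (w n) = (\<Sum>b\<in>B. cmod (c b (v n)) / N (v n))"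
        unfolding N_def by simp
      also have "\<dots> = 1"
        using Npos[of n] unfolding sum_divide_distrib[symmetric] N_def by simp
      finally show ?thesis .
    qed
    have w0: "w \<longlonglongrightarrow> 0"
    proof (rule Lim_null_comparison)
      have "norm (w n) \<le> 1 / Suc n" for n
        using v[of n] Npos[of n] by (simp add: w_def norm_scaleC norm_divide field_simps)
      then show "\<forall>\<^sub>F n in sequentially. norm (w n) \<le> 1 / Suc n" by simp
      show "(\<lambda>n. 1 / real (Suc n)) \<longlonglongrightarrow> 0"
        by (rule LIMSEQ_Suc[OF lim_1_over_n])
    qed
    have "\<forall>d\<subseteq>B. \<exists>l::'a. \<exists>r. strict_mono r \<and>
        (\<forall>e>0. \<forall>\<^sub>F n in sequentially. \<forall>i\<in>d. dist (c i (w (r n))) (c i l) < e)"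
    proof (rule compact_lemma_general[where unproj="\<lambda>l. \<Sum>b\<in>B. l b *\<^sub>C b"])
      show "finite B" by fact
      fix b assume "b \<in> B"
      then have "cmod (c b (w n)) \<le> N (w n)" for n
        unfolding N_def using fin by (intro member_le_sum) auto
      then show "bounded ((\<lambda>x. c b x) ` range w)"
        unfolding Nw by (auto simp: bounded_iff)
    qed (simp_all add: c_sum rep[symmetric])
    then obtain l r where r: "strict_mono (r :: nat \<Rightarrow> nat)"
      and l: "\<And>e. e > 0 \<Longrightarrow> \<forall>\<^sub>F n in sequentially. \<forall>i\<in>B. dist (c i (w (r n))) (c i l) < e"
      by blast
    have lim: "(\<lambda>n. c b (w (r n))) \<longlonglongrightarrow> c b l" if "b \<in> B" for b
      unfolding tendsto_iff
    proof (intro allI impI)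
      fix e :: real assume "e > 0"
      from l[OF this] show "\<forall>\<^sub>F n in sequentially. dist (c b (w (r n))) (c b l) < e"
        by eventually_elim (use that in blast)
    qed
    have "(\<lambda>n. \<Sum>b\<in>B. c b (w (r n)) *\<^sub>C b) \<longlonglongrightarrow> (\<Sum>b\<in>B. c b l *\<^sub>C b)"
      by (intro tendsto_sum bounded_linear.tendsto[OF bounded_linear_scaleC_left] lim)
    then have "(\<lambda>n. w (r n)) \<longlonglongrightarrow> l" unfolding rep[symmetric] .
    moreover have "(\<lambda>n. w (r n)) \<longlonglongrightarrow> 0"
      using LIMSEQ_subseq_LIMSEQ[OF w0 r] by (simp add: comp_def)
    ultimately have "l = 0" by (rule LIMSEQ_unique)
    moreover have "(\<lambda>n. N (w (r n))) \<longlonglongrightarrow> N l"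
      unfolding N_def by (intro tendsto_sum tendsto_norm lim)
    ultimately show False
      using c_scale[of _ 0 0] unfolding Nw by (simp add: LIMSEQ_const_iff N_def)
  qed
  then obtain C where C: "\<And>v. N v \<le> C * norm v" by blast
  have "bounded_linear (c b)" for b
  proof (cases "b \<in> B")
    case True
    show ?thesis
    proof
      show "c b (r *\<^sub>R x) = r *\<^sub>R c b x" for r x
        using c_scale[of b "of_real r" x] by (simp add: scaleC_of_real scaleR_conv_of_real)
      have "cmod (c b x) \<le> N x" for x
        unfolding N_def using fin True by (intro member_le_sum) auto
      then show "\<exists>K. \<forall>x. norm (c b x) \<le> norm x * K"
        using C by (intro exI[of _ C]) (metis mult.commute order_trans)
    qed (rule c_add)
  next
    case False
    then have "c b = (\<lambda>_. 0)"
      unfolding c_def using cvs.representation_ne_zero by blast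
    then show ?thesis by (simp add: bounded_linear_zero)
  qed
  then show thesis using that fin c_scale rep by blast
qed

section \<open>Complex differentiability and Cauchy estimates\<close>

lemma holo_onE:
  assumes "z \<in> S" "holo_on F S"
  obtains D where "(F has_derivative D) (at z)" "\<And>a v. D (a *\<^sub>C v) = a *\<^sub>C D v"
    "D = frechet_derivative F (at z)"
  using assms frechet_derivative_at unfolding holo_on_def by blast

lemma holo_on_subset: "holo_on F S \<Longrightarrow> T \<subseteq> S \<Longrightarrow> holo_on F T"
  unfolding holo_on_def by blast

lemma holo_on_compose_linear:
  assumes "holo_on F S" "bounded_linear c" "\<And>a v. c (a *\<^sub>C v) = a *\<^sub>C c v"
  shows "holo_on (\<lambda>z. c (F z)) S"
  unfolding holo_on_def
proof
  fix z assume "z \<in> S"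
  then obtain D where "(F has_derivative D) (at z)" "\<And>a v. D (a *\<^sub>C v) = a *\<^sub>C D v"
    using assms(1) holo_onE by blast
  then show "\<exists>D. ((\<lambda>z. c (F z)) has_derivative D) (at z) \<and> (\<forall>a v. D (a *\<^sub>C v) = a *\<^sub>C D v)"
    by (intro exI[of _ "\<lambda>v. c (D v)"]) (auto intro: bounded_linear.has_derivative[OF assms(2)] simp: assms(3))
qed

text \<open>Restriction to the complex line through \<open>z\<close> in direction \<open>v\<close>
  reduces this to the Cauchy inequality in one variable.\<close>

lemma Cauchy_estimate_holo:
  fixes F :: "'e::complex_normed_vector \<Rightarrow> complex"
  assumes F: "holo_on F (ball z R)" and bd: "\<And>p. p \<in> ball z R \<Longrightarrow> cmod (F p) \<le> M" and "R > 0"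
  shows "cmod (frechet_derivative F (at z) v) \<le> 2 * M * norm v / R"
proof (cases "v = 0")
  case True
  have "linear (frechet_derivative F (at z))"
    using F \<open>R > 0\<close> by (intro linear_frechet_derivative holo_onD) auto
  then show ?thesis using True by (simp add: linear_0)
next
  case False
  \<comment> \<open>Half of the largest admissible radius, so that the closed disc is mapped into
    the open ball; this is the origin of the factor 2 in the bound.\<close>
  define r where "r = R / (2 * norm v)"
  have r: "r > 0" using False \<open>R > 0\<close> by (simp add: r_def)
  define g where "g = (\<lambda>\<zeta>. F (z + \<zeta> *\<^sub>C v))"
  have inball: "z + \<zeta> *\<^sub>C v \<in> ball z R" if "cmod \<zeta> \<le> r" for \<zeta>
  proof -
    have "cmod \<zeta> * norm v \<le> r * norm v" using that by (intro mult_right_mono) auto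
    also have "\<dots> < R" using False \<open>R > 0\<close> by (simp add: r_def)
    finally show ?thesis by (simp add: dist_norm norm_scaleC)
  qed
  have der: "(g has_field_derivative frechet_derivative F (at (z + \<zeta> *\<^sub>C v)) v) (at \<zeta>)"
    if \<zeta>: "cmod \<zeta> \<le> r" for \<zeta>
  proof -
    obtain D where D: "(F has_derivative D) (at (z + \<zeta> *\<^sub>C v))" "\<And>a v. D (a *\<^sub>C v) = a *\<^sub>C D v"
      "D = frechet_derivative F (at (z + \<zeta> *\<^sub>C v))"
      using holo_onE[OF inball[OF \<zeta>] F] by blast
    have "((\<lambda>\<zeta>. z + \<zeta> *\<^sub>C v) has_derivative (\<lambda>h. h *\<^sub>C v)) (at \<zeta>)"
      by (auto intro!: derivative_eq_intros bounded_linear.has_derivative[OF bounded_linear_scaleC_left])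
    from diff_chain_at[OF this D(1)] show ?thesis
      unfolding has_field_derivative_def D(3)[symmetric]
      by (simp add: g_def comp_def D(2) scaleC_complex_def mult.commute mult_commute_abs)
  qed
  have "cmod ((deriv ^^ 1) g 0) \<le> fact 1 * M / r ^ 1"
  proof (rule Cauchy_inequality)
    show "g holomorphic_on ball 0 r"
      unfolding holomorphic_on_open[OF open_ball] by (meson der less_imp_le mem_ball_0)
    show "continuous_on (cball 0 r) g"
      using der by (intro DERIV_continuous_on[where D="\<lambda>\<zeta>. frechet_derivative F (at (z + \<zeta> *\<^sub>C v)) v"])
        (auto intro: has_field_derivative_at_within)
    show "cmod (g x) \<le> M" if "cmod (0 - x) = r" for x
      unfolding g_def using that by (intro bd inball) simp
  qed (fact r)
  moreover have "deriv g 0 = frechet_derivative F (at z) v"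
    using DERIV_imp_deriv[OF der[of 0]] r by simp
  ultimately show ?thesis by (simp add: r_def field_simps)
qed

text \<open>Applying the Cauchy estimate to differences \<open>F (\<cdot> + h) - F\<close> shows that the derivative is
  locally Lipschitz.\<close>

lemma frechet_derivative_lipschitz:
  fixes F :: "'e::complex_normed_vector \<Rightarrow> complex"
  assumes F: "holo_on F (ball z0 (4 * R))" and "R > 0"
    and bd: "\<And>p. p \<in> ball z0 (4 * R) \<Longrightarrow> cmod (F p) \<le> M"
    and z: "z \<in> ball z0 R" and w: "w \<in> ball z0 R"
  shows "cmod (frechet_derivative F (at w) v - frechet_derivative F (at z) v)
    \<le> 2 * M / R\<^sup>2 * norm (w - z) * norm v"
proof -
  have M: "M \<ge> 0" using bd[of z0] \<open>R > 0\<close> by (smt (verit) centre_in_ball norm_ge_zero)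
  have sub: "ball p (2 * R) \<subseteq> ball z0 (4 * R)" if "p \<in> ball z0 (2 * R)" for p
  proof
    fix q assume "q \<in> ball p (2 * R)"
    then show "q \<in> ball z0 (4 * R)"
      using that dist_triangle[of z0 q p] by simp
  qed
  \<comment> \<open>Three nested radii: points within \<open>2 * R\<close> of \<open>z0\<close> have
    a ball of radius \<open>2 * R\<close> on which \<open>F\<close> is bounded, so \<open>F\<close>
    is Lipschitz there; for \<open>p\<close> within \<open>R\<close> of \<open>z\<close>, both
    \<open>p\<close> and its translate by \<open>w - z\<close> stay within \<open>2 * R\<close> of
    \<open>z0\<close>. The difference \<open>G\<close> is therefore small on a ball of radius
    \<open>R\<close> about \<open>z\<close>.\<close>
  have lip: "cmod (F p - F q) \<le> M / R * norm (p - q)"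
    if "p \<in> ball z0 (2 * R)" "q \<in> ball z0 (2 * R)" for p q
  proof (rule differentiable_bound)
    show "convex (ball z0 (2 * R))" by simp
    fix x assume x: "x \<in> ball z0 (2 * R)"
    then have "x \<in> ball z0 (4 * R)" using \<open>R > 0\<close> by auto
    then show "(F has_derivative frechet_derivative F (at x)) (at x within ball z0 (2 * R))"
      using holo_onD[OF F] by (auto simp: frechet_derivative_works intro: has_derivative_at_withinI)
    show "onorm (frechet_derivative F (at x)) \<le> M / R"
    proof (rule onorm_bound)
      show "0 \<le> M / R" using M \<open>R > 0\<close> by simp
      fix v
      have "cmod (frechet_derivative F (at x) v) \<le> 2 * M * norm v / (2 * R)"
        using sub[OF x] \<open>R > 0\<close> by (intro Cauchy_estimate_holo holo_on_subset[OF F] bd) auto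
      then show "cmod (frechet_derivative F (at x) v) \<le> M / R * norm v" by simp
    qed
  qed fact+
  have shift: "p + (w - z) \<in> ball z0 (2 * R)" "p \<in> ball z0 (2 * R)" if "p \<in> ball z R" for p
  proof -
    have "dist z0 (p + (w - z)) \<le> dist z0 w + dist w (p + (w - z))" by (rule dist_triangle)
    then show "p + (w - z) \<in> ball z0 (2 * R)" using that w by (simp add: dist_norm norm_minus_commute)
    show "p \<in> ball z0 (2 * R)" using that z dist_triangle[of z0 p z] by simp
  qed
  define G where "G = (\<lambda>p. F (p + (w - z)) - F p)"
  have der: "(G has_derivative
      (\<lambda>v. frechet_derivative F (at (p + (w - z))) v - frechet_derivative F (at p) v)) (at p)"
    and hol: "frechet_derivative F (at (p + (w - z))) (a *\<^sub>C v) = a *\<^sub>C frechet_derivative F (at (p + (w - z))) v"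
      "frechet_derivative F (at p) (a *\<^sub>C v) = a *\<^sub>C frechet_derivative F (at p) v"
    if "p \<in> ball z R" for p a v
  proof -
    have 4: "p + (w - z) \<in> ball z0 (4 * R)" "p \<in> ball z0 (4 * R)"
      using shift[OF that] \<open>R > 0\<close> by auto
    obtain D where D: "(F has_derivative D) (at (p + (w - z)))" "\<And>a v. D (a *\<^sub>C v) = a *\<^sub>C D v"
      "D = frechet_derivative F (at (p + (w - z)))"
      using holo_onE[OF 4(1) F] by blast
    obtain E where E: "(F has_derivative E) (at p)" "\<And>a v. E (a *\<^sub>C v) = a *\<^sub>C E v"
      "E = frechet_derivative F (at p)"
      using holo_onE[OF 4(2) F] by blast
    have "((\<lambda>p. p + (w - z)) has_derivative (\<lambda>h. h)) (at p)"
      by (auto intro!: derivative_eq_intros)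
    from diff_chain_at[OF this D(1)] have "((\<lambda>p. F (p + (w - z))) has_derivative D) (at p)"
      by (simp add: comp_def)
    from has_derivative_diff[OF this E(1)] D(2) E(2)
    show "(G has_derivative
        (\<lambda>v. frechet_derivative F (at (p + (w - z))) v - frechet_derivative F (at p) v)) (at p)"
      "frechet_derivative F (at (p + (w - z))) (a *\<^sub>C v) = a *\<^sub>C frechet_derivative F (at (p + (w - z))) v"
      "frechet_derivative F (at p) (a *\<^sub>C v) = a *\<^sub>C frechet_derivative F (at p) v"
      unfolding G_def D(3)[symmetric] E(3)[symmetric] by auto
  qed
  have "cmod (frechet_derivative G (at z) v) \<le> 2 * (M / R * norm (w - z)) * norm v / R"
  proof (rule Cauchy_estimate_holo)
    show "holo_on G (ball z R)"
      unfolding holo_on_def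
    proof
      fix p assume p: "p \<in> ball z R"
      show "\<exists>D. (G has_derivative D) (at p) \<and> (\<forall>a v. D (a *\<^sub>C v) = a *\<^sub>C D v)"
        using der[OF p] hol[OF p]
        by (intro exI[of _ "\<lambda>v. frechet_derivative F (at (p + (w - z))) v - frechet_derivative F (at p) v"])
          (simp add: scaleC_complex_def right_diff_distrib)
    qed
    fix p assume "p \<in> ball z R"
    from lip[OF shift[OF this]] show "cmod (G p) \<le> M / R * norm (w - z)"
      by (simp add: G_def)
  qed fact
  moreover have "frechet_derivative G (at z) v = frechet_derivative F (at w) v - frechet_derivative F (at z) v"
    using frechet_derivative_at[OF der[of z], THEN fun_cong, of v] \<open>R > 0\<close> by simp
  ultimately show ?thesis by (simp add: power2_eq_square field_simps)
qed

text \<open>\<open>F\<close> is continuous at \<open>z0\<close>, hence bounded on a small ball,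
  where its derivative is Lipschitz. The error from moving the base point is at most a multiple of
  \<open>norm (u s - z0) * norm (D s)\<close>; the remaining term is a fixed bounded linear map
  applied to \<open>D s\<close>.\<close>

lemma holo_on_frechet_tendsto:
  fixes F :: "'e::complex_normed_vector \<Rightarrow> complex"
  assumes F: "holo_on F S" and "open S" "z0 \<in> S"
    and u: "(u \<longlongrightarrow> z0) Q" and D: "(D \<longlongrightarrow> v0) Q"
  shows "((\<lambda>s. frechet_derivative F (at (u s)) (D s)) \<longlongrightarrow> frechet_derivative F (at z0) v0) Q"
proof -
  have "isCont F z0"
    using holo_onD[OF F \<open>z0 \<in> S\<close>] by (rule differentiable_imp_continuous_within)
  then have "\<forall>\<^sub>F p in nhds z0. dist (F p) (F z0) < 1"
    using tendstoD[of F "F z0" "nhds z0" 1] by (simp add: isCont_def tendsto_nhds_iff)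
  moreover have "\<forall>\<^sub>F p in nhds z0. p \<in> S"
    using assms(2,3) by (rule eventually_nhds_in_open)
  ultimately have "\<forall>\<^sub>F p in nhds z0. dist (F p) (F z0) < 1 \<and> p \<in> S" by eventually_elim simp
  then obtain e where e: "e > 0" "\<And>p. dist p z0 < e \<Longrightarrow> dist (F p) (F z0) < 1 \<and> p \<in> S"
    unfolding eventually_nhds_metric by blast
  define R where "R = e / 4"
  define M where "M = cmod (F z0) + 1"
  have R: "R > 0" using e by (simp add: R_def)
  have sub: "ball z0 (4 * R) \<subseteq> S" using e by (auto simp: R_def dist_commute)
  have bd: "cmod (F p) \<le> M" if "p \<in> ball z0 (4 * R)" for p
    using e(2)[of p] that norm_triangle_ineq2[of "F p" "F z0"]
    by (simp add: R_def M_def dist_commute dist_norm)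
  have lin: "bounded_linear (frechet_derivative F (at z0))"
    using holo_onE[OF \<open>z0 \<in> S\<close> F] has_derivative_bounded_linear by blast
  have "\<forall>\<^sub>F s in Q. u s \<in> ball z0 R"
    using u R by (auto simp: tendsto_iff dist_commute)
  then have ev: "\<forall>\<^sub>F s in Q. norm (frechet_derivative F (at (u s)) (D s) - frechet_derivative F (at z0) (D s))
      \<le> 2 * M / R\<^sup>2 * norm (u s - z0) * norm (D s)"
    by (rule eventually_mono)
      (rule frechet_derivative_lipschitz[OF holo_on_subset[OF F sub] R bd], auto simp: R)
  have "((\<lambda>s. 2 * M / R\<^sup>2 * norm (u s - z0) * norm (D s)) \<longlongrightarrow> 2 * M / R\<^sup>2 * norm (z0 - z0) * norm v0) Q"
    by (intro tendsto_intros u D)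
  then have 0: "((\<lambda>s. frechet_derivative F (at (u s)) (D s) - frechet_derivative F (at z0) (D s)) \<longlongrightarrow> 0) Q"
    by (intro Lim_null_comparison[OF ev]) simp
  from tendsto_add[OF 0 bounded_linear.tendsto[OF lin D]] show ?thesis by simp
qed

text \<open>The Cauchy estimates are scalar, so the values are split into coordinates. This is what
  keeps path velocities continuous under a change of chart.\<close>

lemma holo_on_frechet_continuous_on:
  fixes F :: "'e::complex_normed_vector \<Rightarrow> 'f::complex_finite_dim"
  assumes F: "holo_on F S" and "open S" and u: "continuous_on A u" "\<And>s. s \<in> A \<Longrightarrow> u s \<in> S"
    and D: "continuous_on A D"
  shows "continuous_on A (\<lambda>s. frechet_derivative F (at (u s)) (D s))"
proof -
  obtain B and c :: "'f \<Rightarrow> 'f \<Rightarrow> complex"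
    where B: "finite B" "\<And>b. bounded_linear (c b)" "\<And>b a v. c b (a *\<^sub>C v) = a * c b v"
    "\<And>v. v = (\<Sum>b\<in>B. c b v *\<^sub>C b)"
    using complex_finite_dim_coordinates by blast
  have eq: "frechet_derivative F (at (u s)) (D s)
      = (\<Sum>b\<in>B. frechet_derivative (\<lambda>z. c b (F z)) (at (u s)) (D s) *\<^sub>C b)" if s: "s \<in> A" for s
  proof -
    obtain E where E: "(F has_derivative E) (at (u s))" "E = frechet_derivative F (at (u s))"
      using holo_onE[OF u(2)[OF s] F] by blast
    have "(\<lambda>v. c b (E v)) = frechet_derivative (\<lambda>z. c b (F z)) (at (u s))" for b
      by (rule frechet_derivative_at) (rule bounded_linear.has_derivative[OF B(2) E(1)])
    from fun_cong[OF this] show ?thesis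
      unfolding E(2)[symmetric] using B(4)[of "E (D s)"] by simp
  qed
  have "continuous_on A (\<lambda>s. frechet_derivative (\<lambda>z. c b (F z)) (at (u s)) (D s))" for b
    unfolding continuous_on_def
  proof
    fix s assume "s \<in> A"
    have "holo_on (\<lambda>z. c b (F z)) S"
      using F B(2) by (rule holo_on_compose_linear) (simp add: B(3) scaleC_complex_def)
    then show "((\<lambda>s. frechet_derivative (\<lambda>z. c b (F z)) (at (u s)) (D s)) \<longlongrightarrow>
        frechet_derivative (\<lambda>z. c b (F z)) (at (u s)) (D s)) (at s within A)"
      using \<open>open S\<close> u(2)[OF \<open>s \<in> A\<close>] u(1) D \<open>s \<in> A\<close>
      by (intro holo_on_frechet_tendsto) (auto simp: continuous_on_def)
  qed
  then have "continuous_on A (\<lambda>s. \<Sum>b\<in>B. frechet_derivative (\<lambda>z. c b (F z)) (at (u s)) (D s) *\<^sub>C b)"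
    by (intro continuous_on_sum bounded_linear.continuous_on[OF bounded_linear_scaleC_left])
  then show ?thesis using eq by (simp cong: continuous_on_cong)
qed

section \<open>Holomorphic maps in charts\<close>

lemma chartD:
  assumes X: "complex_manifold X" and c: "(U, \<kappa>) \<in> atlas X"
  shows "openin (mtop X) U" "U \<subseteq> points X" "inj_on \<kappa> U"
    and "openin (mtop X) W \<Longrightarrow> open (\<kappa> ` (U \<inter> W))"
    and "continuous_map (subtopology (mtop X) U) euclidean \<kappa>"
    and "continuous_map (top_of_set (\<kappa> ` U)) (mtop X) (inv_into U \<kappa>)"
proof -
  have "is_chart (mtop X) (U, \<kappa>)"
    using X c unfolding complex_manifold_def by blast
  then have U: "openin (mtop X) U" and O: "open (\<kappa> ` U)"
    and h: "homeomorphic_map (subtopology (mtop X) U) (top_of_set (\<kappa> ` U)) \<kappa>"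
    by (simp_all add: is_chart_def)
  show "openin (mtop X) U" by fact
  show "U \<subseteq> points X" unfolding points_def using U by (rule openin_subset)
  have ts: "topspace (subtopology (mtop X) U) = U"
    using openin_subset[OF U] by (simp add: inf.absorb2)
  show inj: "inj_on \<kappa> U"
    using homeomorphic_imp_injective_map[OF h] unfolding ts .
  show "continuous_map (subtopology (mtop X) U) euclidean \<kappa>"
    using homeomorphic_imp_continuous_map[OF h] by (simp add: continuous_map_in_subtopology)
  obtain g where g: "homeomorphic_maps (subtopology (mtop X) U) (top_of_set (\<kappa> ` U)) \<kappa> g"
    using h by (auto simp: homeomorphic_map_maps)
  have eq: "g z = inv_into U \<kappa> z" if z: "z \<in> \<kappa> ` U" for z
  proof -
    obtain x where x: "x \<in> U" "z = \<kappa> x" using z by blast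
    then have "g z = x" using g ts by (auto simp: homeomorphic_maps_def)
    then show ?thesis using x inj by simp
  qed
  have "continuous_map (top_of_set (\<kappa> ` U)) (subtopology (mtop X) U) (inv_into U \<kappa>)"
    by (rule continuous_map_eq[of _ _ g]) (use g eq in \<open>auto simp: homeomorphic_maps_def\<close>)
  then show "continuous_map (top_of_set (\<kappa> ` U)) (mtop X) (inv_into U \<kappa>)"
    by (simp add: continuous_map_in_subtopology)
  assume W: "openin (mtop X) W"
  have "openin (subtopology (mtop X) U) (U \<inter> W)"
    using W by (auto simp: openin_subtopology)
  then have "openin (top_of_set (\<kappa> ` U)) (\<kappa> ` (U \<inter> W))"
    using homeomorphic_imp_open_map[OF h] by (simp add: open_map_def)
  then show "open (\<kappa> ` (U \<inter> W))"
    using O openin_open_trans by blast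
qed

lemma chart_around:
  assumes "complex_manifold X" "x \<in> points X"
  obtains U \<kappa> where "(U, \<kappa>) \<in> atlas X" "x \<in> U"
  using assms unfolding complex_manifold_def by force

lemma chart_image_open:
  assumes "complex_manifold X" "(U, \<kappa>) \<in> atlas X"
  shows "open (\<kappa> ` U)"
  using chartD(4)[OF assms chartD(1)[OF assms]] by simp

text \<open>Charts composed with holomorphic maps, and disc maps, are treated alike in this form.\<close>

definition holo_coord ::
  "('a, 'e::complex_finite_dim) cmanifold \<Rightarrow> 'a set \<Rightarrow> ('a \<Rightarrow> 'f::complex_finite_dim) \<Rightarrow> bool" where
  "holo_coord X W G \<longleftrightarrow> openin (mtop X) W \<and>
     (\<forall>(U, \<kappa>)\<in>atlas X. holo_on (G \<circ> inv_into U \<kappa>) (\<kappa> ` (U \<inter> W)))"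

lemma holo_coordD:
  assumes "holo_coord X W G"
  shows "openin (mtop X) W" "(U, \<kappa>) \<in> atlas X \<Longrightarrow> holo_on (G \<circ> inv_into U \<kappa>) (\<kappa> ` (U \<inter> W))"
  using assms unfolding holo_coord_def by blast+

lemma holo_coord_chart:
  assumes "complex_manifold X" "(V, \<psi>) \<in> atlas X"
  shows "holo_coord X V \<psi>"
  using assms chartD(1)[OF assms] unfolding holo_coord_def complex_manifold_def by blast

lemma holomorphic_map_holo_coord:
  assumes X: "complex_manifold X" and Y: "complex_manifold Y" and f: "holomorphic_map X Y f"
    and V: "(V, \<psi>) \<in> atlas Y"
  shows "holo_coord X {x \<in> points X. f x \<in> V} (\<psi> \<circ> f)"
  unfolding holo_coord_def
proof (intro conjI ballI, safe)
  have "continuous_map (mtop X) (mtop Y) f"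
    using f by (simp add: holomorphic_map_def)
  from openin_continuous_map_preimage[OF this chartD(1)[OF Y V]]
  show "openin (mtop X) {x \<in> points X. f x \<in> V}" by (simp add: points_def)
next
  fix U \<kappa> assume U: "(U, \<kappa>) \<in> atlas X"
  have "holo_on (\<psi> \<circ> f \<circ> inv_into U \<kappa>) (\<kappa> ` {x \<in> U. f x \<in> V})"
    using f U V unfolding holomorphic_map_def by blast
  then show "holo_on (\<psi> \<circ> f \<circ> inv_into U \<kappa>) (\<kappa> ` (U \<inter> {x \<in> points X. f x \<in> V}))"
    by (rule holo_on_subset) auto
qed

lemma disc_maps_iff:
  assumes X: "complex_manifold X"
  shows "\<phi> \<in> disc_maps X \<longleftrightarrow> continuous_map (mtop X) euclidean \<phi> \<and>
    (\<forall>x\<in>points X. cmod (\<phi> x) < 1) \<and> holo_coord X (points X) \<phi>"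
proof -
  have *: "holo_on ((\<lambda>z. z) \<circ> \<phi> \<circ> inv_into U \<kappa>) (\<kappa> ` {x \<in> U. \<phi> x \<in> ball 0 1})
      \<longleftrightarrow> holo_on (\<phi> \<circ> inv_into U \<kappa>) (\<kappa> ` (U \<inter> points X))"
    if "(U, \<kappa>) \<in> atlas X" "\<forall>x\<in>points X. cmod (\<phi> x) < 1" for U \<kappa>
  proof -
    have "{x \<in> U. \<phi> x \<in> ball 0 1} = U \<inter> points X"
      using that chartD(2)[OF X that(1)] by auto
    then show ?thesis by (simp add: comp_def)
  qed
  have "\<phi> \<in> disc_maps X \<longleftrightarrow> continuous_map (mtop X) euclidean \<phi> \<and>
      (\<forall>x\<in>points X. cmod (\<phi> x) < 1) \<and>
      (\<forall>(U, \<kappa>)\<in>atlas X. holo_on ((\<lambda>z. z) \<circ> \<phi> \<circ> inv_into U \<kappa>) (\<kappa> ` {x \<in> U. \<phi> x \<in> ball 0 1}))"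
    unfolding disc_maps_def holomorphic_map_def unit_disc_def
    by (auto simp: continuous_map_in_subtopology points_def)
  also have "\<dots> \<longleftrightarrow> continuous_map (mtop X) euclidean \<phi> \<and>
      (\<forall>x\<in>points X. cmod (\<phi> x) < 1) \<and> holo_coord X (points X) \<phi>"
    using * unfolding holo_coord_def by (auto simp: points_def)
  finally show ?thesis .
qed

section \<open>Composition of holomorphic maps and disc maps\<close>

lemma holo_on_compose:
  assumes F: "holo_on F S" and G: "holo_on G T" and "\<And>z. z \<in> S \<Longrightarrow> F z \<in> T"
  shows "holo_on (\<lambda>z. G (F z)) S"
  unfolding holo_on_def
proof
  fix z assume z: "z \<in> S"
  obtain D where D: "(F has_derivative D) (at z)" "\<And>a v. D (a *\<^sub>C v) = a *\<^sub>C D v"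
    using holo_onE[OF z F] by blast
  obtain E where E: "(G has_derivative E) (at (F z))" "\<And>a v. E (a *\<^sub>C v) = a *\<^sub>C E v"
    using holo_onE[OF assms(3)[OF z] G] by blast
  show "\<exists>D. ((\<lambda>z. G (F z)) has_derivative D) (at z) \<and> (\<forall>a v. D (a *\<^sub>C v) = a *\<^sub>C D v)"
    using diff_chain_at[OF D(1) E(1)] D(2) E(2)
    by (intro exI[of _ "E \<circ> D"]) (simp add: comp_def)
qed

lemma holo_on_transform:
  assumes "holo_on F S" "open S" "\<And>z. z \<in> S \<Longrightarrow> F z = G z"
  shows "holo_on G S"
  using assms unfolding holo_on_def by (metis has_derivative_transform_within_open)

lemma disc_maps_compose_holomorphic:
  assumes X: "complex_manifold X" and \<phi>: "\<phi> \<in> disc_maps X"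
    and h: "h holomorphic_on ball 0 1" "\<And>z. cmod z < 1 \<Longrightarrow> cmod (h z) < 1"
  shows "(\<lambda>x. h (\<phi> x)) \<in> disc_maps X"
proof -
  have \<phi>': "continuous_map (mtop X) euclidean \<phi>" "\<And>x. x \<in> points X \<Longrightarrow> cmod (\<phi> x) < 1"
    "holo_coord X (points X) \<phi>"
    using \<phi> disc_maps_iff[OF X] by auto
  have "continuous_map (mtop X) (top_of_set (ball 0 1)) \<phi>"
    using \<phi>' by (auto simp: continuous_map_in_subtopology points_def)
  moreover have "continuous_map (top_of_set (ball 0 1)) euclidean h"
    using holomorphic_on_imp_continuous_on[OF h(1)] by simp
  ultimately have "continuous_map (mtop X) euclidean (h \<circ> \<phi>)"
    by (rule continuous_map_compose)
  moreover have "holo_on ((\<lambda>x. h (\<phi> x)) \<circ> inv_into U \<kappa>) (\<kappa> ` (U \<inter> points X))"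
    if U: "(U, \<kappa>) \<in> atlas X" for U \<kappa>
  proof -
    have "holo_on (\<lambda>z. h ((\<phi> \<circ> inv_into U \<kappa>) z)) (\<kappa> ` (U \<inter> points X))"
    proof (rule holo_on_compose[where F="\<phi> \<circ> inv_into U \<kappa>" and G=h and T="ball 0 1"])
      show "holo_on (\<phi> \<circ> inv_into U \<kappa>) (\<kappa> ` (U \<inter> points X))"
        using holo_coordD(2)[OF \<phi>'(3) U] .
      show "holo_on h (ball 0 1)" using h(1) holo_on_complex_iff by blast
    qed (use \<phi>'(2) chartD(3)[OF X U] in auto)
    then show ?thesis by (simp add: comp_def)
  qed
  ultimately show ?thesis
    unfolding disc_maps_iff[OF X] using \<phi>' h(2) unfolding holo_coord_def comp_def by auto
qed

text \<open>Complex differentiability is local. Near each point \<open>G \<circ> f\<close> factors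
  through a chart \<open>(V, \<psi>)\<close> around the image point, on the open set
  \<open>W\<close> of points that \<open>f\<close> sends into \<open>V\<close>.\<close>

lemma holo_coord_compose:
  assumes X: "complex_manifold X" and Y: "complex_manifold Y" and f: "holomorphic_map X Y f"
    and G: "holo_coord Y (points Y) G"
  shows "holo_coord X (points X) (G \<circ> f)"
  unfolding holo_coord_def
proof (intro conjI ballI, safe)
  show "openin (mtop X) (points X)" by (simp add: points_def)
  fix U \<kappa> assume U: "(U, \<kappa>) \<in> atlas X"
  have cf: "continuous_map (mtop X) (mtop Y) f"
    using f by (simp add: holomorphic_map_def)
  show "holo_on (G \<circ> f \<circ> inv_into U \<kappa>) (\<kappa> ` (U \<inter> points X))"
    unfolding holo_on_def
  proof
    fix z assume "z \<in> \<kappa> ` (U \<inter> points X)"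
    then obtain x where x: "x \<in> U" "x \<in> points X" "z = \<kappa> x" by blast
    have "f x \<in> points Y"
      using continuous_map_image_subset_topspace[OF cf] x(2) by (auto simp: points_def)
    then obtain V \<psi> where V: "(V, \<psi>) \<in> atlas Y" "f x \<in> V"
      using chart_around[OF Y] by blast
    define W where "W = {x \<in> points X. f x \<in> V}"
    note hf = holomorphic_map_holo_coord[OF X Y f V(1), folded W_def]
    have 1: "holo_on (\<psi> \<circ> f \<circ> inv_into U \<kappa>) (\<kappa> ` (U \<inter> W))"
      using holo_coordD(2)[OF hf U] .
    have 2: "holo_on (G \<circ> inv_into V \<psi>) (\<psi> ` (V \<inter> points Y))"
      using holo_coordD(2)[OF G V(1)] .
    have inv: "inv_into U \<kappa> w \<in> W" if "w \<in> \<kappa> ` (U \<inter> W)" for w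
      using that chartD(3)[OF X U] by auto
    have "holo_on (\<lambda>w. (G \<circ> inv_into V \<psi>) ((\<psi> \<circ> f \<circ> inv_into U \<kappa>) w)) (\<kappa> ` (U \<inter> W))"
      by (rule holo_on_compose[OF 1 2]) (use inv chartD(2)[OF Y V(1)] in \<open>auto simp: W_def\<close>)
    then have "holo_on (G \<circ> f \<circ> inv_into U \<kappa>) (\<kappa> ` (U \<inter> W))"
    proof (rule holo_on_transform)
      show "open (\<kappa> ` (U \<inter> W))" using chartD(4)[OF X U holo_coordD(1)[OF hf]] .
      fix w assume "w \<in> \<kappa> ` (U \<inter> W)"
      from inv[OF this] show "(G \<circ> inv_into V \<psi>) ((\<psi> \<circ> f \<circ> inv_into U \<kappa>) w) = (G \<circ> f \<circ> inv_into U \<kappa>) w"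
        using chartD(3)[OF Y V(1)] by (simp add: W_def)
    qed
    moreover have "z \<in> \<kappa> ` (U \<inter> W)" using x V by (auto simp: W_def)
    ultimately show "\<exists>D. (G \<circ> f \<circ> inv_into U \<kappa> has_derivative D) (at z) \<and> (\<forall>a v. D (a *\<^sub>C v) = a *\<^sub>C D v)"
      unfolding holo_on_def by blast
  qed
qed

lemma disc_maps_compose_map:
  assumes X: "complex_manifold X" and Y: "complex_manifold Y" and f: "holomorphic_map X Y f"
    and \<phi>: "\<phi> \<in> disc_maps Y"
  shows "\<phi> \<circ> f \<in> disc_maps X"
proof -
  have cf: "continuous_map (mtop X) (mtop Y) f"
    using f by (simp add: holomorphic_map_def)
  then have "f x \<in> points Y" if "x \<in> points X" for x
    using continuous_map_image_subset_topspace[OF cf] that by (auto simp: points_def)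
  then show ?thesis
    using \<phi> continuous_map_compose[OF cf, of euclidean \<phi>] holo_coord_compose[OF X Y f, of \<phi>]
    unfolding disc_maps_iff[OF X] disc_maps_iff[OF Y] by auto
qed

text \<open>This is the source of the contraction: the rescaled map competes in the suprema that
  define the metric at the original point.\<close>

lemma disc_maps_scaled_compose_map:
  assumes X: "complex_manifold X" and Y: "complex_manifold Y" and f: "holomorphic_map X Y f"
    and \<phi>: "\<phi> \<in> disc_maps Y" and k: "k > 0" "\<And>x. x \<in> points X \<Longrightarrow> cmod (\<phi> (f x)) < k"
  shows "(\<lambda>x. \<phi> (f x) / of_real k) \<in> disc_maps X"
proof -
  have \<phi>f: "continuous_map (mtop X) euclidean (\<phi> \<circ> f)" "holo_coord X (points X) (\<phi> \<circ> f)"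
    using disc_maps_compose_map[OF X Y f \<phi>] disc_maps_iff[OF X] by auto
  have "continuous_map (mtop X) euclidean ((\<lambda>z. z / of_real k) \<circ> (\<phi> \<circ> f))"
    by (rule continuous_map_compose[OF \<phi>f(1)]) (use k in \<open>auto intro!: continuous_intros\<close>)
  moreover have "holo_coord X (points X) (\<lambda>x. \<phi> (f x) / of_real k)"
    unfolding holo_coord_def
  proof (intro conjI ballI, safe)
    show "openin (mtop X) (points X)" by (simp add: points_def)
    fix U \<kappa> assume "(U, \<kappa>) \<in> atlas X"
    from holo_coordD(2)[OF \<phi>f(2) this]
    have "holo_on (\<lambda>z. (\<phi> \<circ> f \<circ> inv_into U \<kappa>) z / of_real k) (\<kappa> ` (U \<inter> points X))"
      by (rule holo_on_compose_linear) (auto simp: bounded_linear_divide scaleC_complex_def)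
    then show "holo_on ((\<lambda>x. \<phi> (f x) / of_real k) \<circ> inv_into U \<kappa>) (\<kappa> ` (U \<inter> points X))"
      by (simp add: comp_def)
  qed
  ultimately show ?thesis
    unfolding disc_maps_iff[OF X] using k by (auto simp: comp_def norm_divide)
qed

section \<open>Smooth paths seen through holomorphic coordinates\<close>

lemma chain_along_path:
  assumes X: "complex_manifold X" and \<gamma>: "continuous_map (top_of_set {a..b}) (mtop X) \<gamma>"
    and G: "holo_coord X W G" and U: "(U, \<kappa>) \<in> atlas X"
    and s: "s \<in> {a..b}" "\<gamma> s \<in> U" "\<gamma> s \<in> W"
    and d: "((\<kappa> \<circ> \<gamma>) has_vector_derivative d) (at s within {a..b})"
  shows "((G \<circ> \<gamma>) has_vector_derivative frechet_derivative (G \<circ> inv_into U \<kappa>) (at (\<kappa> (\<gamma> s))) d)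
    (at s within {a..b})"
proof -
  obtain E where E: "(G \<circ> inv_into U \<kappa> has_derivative E) (at ((\<kappa> \<circ> \<gamma>) s))"
    "E = frechet_derivative (G \<circ> inv_into U \<kappa>) (at (\<kappa> (\<gamma> s)))"
    using holo_onE[OF _ holo_coordD(2)[OF G U], of "\<kappa> (\<gamma> s)"] s by (metis IntI comp_apply imageI)
  have "((G \<circ> inv_into U \<kappa>) \<circ> (\<kappa> \<circ> \<gamma>) has_derivative E \<circ> (\<lambda>h. h *\<^sub>R d)) (at s within {a..b})"
    using d unfolding has_vector_derivative_def
    by (rule diff_chain_within) (rule has_derivative_at_withinI[OF E(1)])
  moreover have "E \<circ> (\<lambda>h. h *\<^sub>R d) = (\<lambda>h. h *\<^sub>R E d)"
    using has_derivative_linear[OF E(1)] by (auto simp: linear_scale)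
  ultimately have 1: "((G \<circ> inv_into U \<kappa>) \<circ> (\<kappa> \<circ> \<gamma>) has_vector_derivative E d) (at s within {a..b})"
    by (simp only: has_vector_derivative_def)
  have "openin (top_of_set {a..b}) {s \<in> {a..b}. \<gamma> s \<in> U}"
    using openin_continuous_map_preimage[OF \<gamma> chartD(1)[OF X U]] by simp
  then obtain e where e: "e > 0" "\<And>t. t \<in> {a..b} \<Longrightarrow> dist t s < e \<Longrightarrow> \<gamma> t \<in> U"
    using s unfolding openin_euclidean_subtopology_iff by blast
  show ?thesis
    unfolding E(2)[symmetric]
    by (rule has_vector_derivative_transform_within[OF 1 e(1) s(1)])
      (use e(2) chartD(3)[OF X U] in auto)
qed

text \<open>A path need not stay in one chart. Taking \<open>D\<close> to be the vector derivative
  itself makes the local chain-rule formulas agree by uniqueness of derivatives, so only continuity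
  remains, and this can be checked near each time in a single chart.\<close>

lemma C1_on_holo_coord:
  assumes X: "complex_manifold X" and \<gamma>: "continuous_map (top_of_set {a..b}) (mtop X) \<gamma>"
    and "a < b" and C1: "C1_on X a b \<gamma>" and G: "holo_coord X W G"
  obtains D where "continuous_on {s \<in> {a..b}. \<gamma> s \<in> W} D"
    "\<And>s. s \<in> {a..b} \<Longrightarrow> \<gamma> s \<in> W \<Longrightarrow> ((G \<circ> \<gamma>) has_vector_derivative D s) (at s within {a..b})"
proof
  define S where "S = {s \<in> {a..b}. \<gamma> s \<in> W}"
  define D where "D = (\<lambda>s. vector_derivative (G \<circ> \<gamma>) (at s within {a..b}))"
  have "((G \<circ> \<gamma>) has_vector_derivative D s0) (at s0 within {a..b}) \<and> continuous (at s0 within S) D"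
    if s0: "s0 \<in> S" for s0
  proof -
    have "\<gamma> s0 \<in> points X"
      using s0 openin_subset[OF holo_coordD(1)[OF G]] by (auto simp: S_def points_def)
    then obtain U \<kappa> where U: "(U, \<kappa>) \<in> atlas X" "\<gamma> s0 \<in> U"
      using chart_around[OF X] by blast
    obtain D0 where D0: "continuous_on {s \<in> {a..b}. \<gamma> s \<in> U} D0"
      "\<And>s. s \<in> {a..b} \<Longrightarrow> \<gamma> s \<in> U \<Longrightarrow> ((\<kappa> \<circ> \<gamma>) has_vector_derivative D0 s) (at s within {a..b})"
      using C1 U(1) unfolding C1_on_def by blast
    define A where "A = {s \<in> {a..b}. \<gamma> s \<in> U} \<inter> S"
    define D1 where "D1 = (\<lambda>s. frechet_derivative (G \<circ> inv_into U \<kappa>) (at ((\<kappa> \<circ> \<gamma>) s)) (D0 s))"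
    have D1: "((G \<circ> \<gamma>) has_vector_derivative D1 s) (at s within {a..b})" if "s \<in> A" for s
      unfolding D1_def comp_apply[of \<kappa>]
      using that by (intro chain_along_path[OF X \<gamma> G U(1)] D0(2)) (auto simp: A_def S_def)
    have eq: "D1 s = D s" if "s \<in> A" for s
      unfolding D_def
    proof (rule vector_derivative_within[OF _ D1[OF that], symmetric])
      show "at s within {a..b} \<noteq> bot"
        using trivial_limit_within[of s "{a..b}"] islimpt_Icc[of a b s] \<open>a < b\<close> that
        by (auto simp: A_def)
    qed
    have "continuous_on {s \<in> {a..b}. \<gamma> s \<in> U} (\<kappa> \<circ> \<gamma>)"
      using D0(2) unfolding continuous_on_eq_continuous_within
      by (auto intro!: continuous_within_subset[OF has_vector_derivative_continuous])
    then have "continuous_on A (\<kappa> \<circ> \<gamma>)" by (rule continuous_on_subset) (auto simp: A_def)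
    then have "continuous_on A D1"
      unfolding D1_def
      by (intro holo_on_frechet_continuous_on[OF holo_coordD(2)[OF G U(1)]
            chartD(4)[OF X U(1) holo_coordD(1)[OF G]]] continuous_on_subset[OF D0(1)])
        (auto simp: A_def S_def)
    then have "continuous_on A D" using eq by (simp cong: continuous_on_cong)
    moreover have s0A: "s0 \<in> A" using s0 U by (auto simp: A_def S_def)
    ultimately have "continuous (at s0 within A) D"
      by (simp add: continuous_on_eq_continuous_within)
    \<comment> \<open>\<open>A\<close> is the part of \<open>S\<close> on which the path lies in
      \<open>U\<close>. As this is relatively open in the interval, both sets agree near
      \<open>s0\<close>.\<close>
    moreover have "at s0 within S = at s0 within A"
    proof -
      have "openin (top_of_set {a..b}) {s \<in> {a..b}. \<gamma> s \<in> U}"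
        using openin_continuous_map_preimage[OF \<gamma> chartD(1)[OF X U(1)]] by simp
      then obtain T where T: "open T" "{s \<in> {a..b}. \<gamma> s \<in> U} = {a..b} \<inter> T"
        by (auto simp: openin_open)
      show ?thesis
      proof (rule at_within_nhd[of s0 T])
        show "s0 \<in> T" using T(2) s0A unfolding A_def by blast
        show "S \<inter> T - {s0} = A \<inter> T - {s0}"
          unfolding A_def T(2) by (auto simp: S_def)
      qed (fact T(1))
    qed
    ultimately show ?thesis using D1[OF s0A] eq[OF s0A] by simp
  qed
  then show "continuous_on {s \<in> {a..b}. \<gamma> s \<in> W} D"
    "\<And>s. s \<in> {a..b} \<Longrightarrow> \<gamma> s \<in> W \<Longrightarrow> ((G \<circ> \<gamma>) has_vector_derivative D s) (at s within {a..b})"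
    unfolding S_def[symmetric] by (auto simp: continuous_on_eq_continuous_within S_def)
qed

text \<open>A target chart composed with \<open>f\<close> is a holomorphic coordinate on an open
  subset of the source, so the previous lemma applies to it directly.\<close>

lemma C1_on_compose_map:
  assumes X: "complex_manifold X" and Y: "complex_manifold Y" and f: "holomorphic_map X Y f"
    and \<gamma>: "continuous_map (top_of_set {a..b}) (mtop X) \<gamma>" and "a < b" and C1: "C1_on X a b \<gamma>"
  shows "C1_on Y a b (f \<circ> \<gamma>)"
  unfolding C1_on_def
proof (intro ballI, clarify)
  fix V \<psi> assume V: "(V, \<psi>) \<in> atlas Y"
  obtain D where D: "continuous_on {s \<in> {a..b}. \<gamma> s \<in> {x \<in> points X. f x \<in> V}} D"
    "\<And>s. s \<in> {a..b} \<Longrightarrow> \<gamma> s \<in> {x \<in> points X. f x \<in> V} \<Longrightarrow>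
       ((\<psi> \<circ> f \<circ> \<gamma>) has_vector_derivative D s) (at s within {a..b})"
    using C1_on_holo_coord[OF X \<gamma> \<open>a < b\<close> C1 holomorphic_map_holo_coord[OF X Y f V]] by blast
  have "\<gamma> s \<in> points X" if "s \<in> {a..b}" for s
    using continuous_map_image_subset_topspace[OF \<gamma>] that by (auto simp: points_def)
  then have "{s \<in> {a..b}. \<gamma> s \<in> {x \<in> points X. f x \<in> V}} = {s \<in> {a..b}. (f \<circ> \<gamma>) s \<in> V}"
    by auto
  then show "\<exists>D. continuous_on {s \<in> {a..b}. (f \<circ> \<gamma>) s \<in> V} D \<and>
      (\<forall>s\<in>{a..b}. (f \<circ> \<gamma>) s \<in> V \<longrightarrow> (\<psi> \<circ> (f \<circ> \<gamma>) has_vector_derivative D s) (at s within {a..b}))"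
    using D \<open>\<And>s. s \<in> {a..b} \<Longrightarrow> \<gamma> s \<in> points X\<close> by (intro exI[of _ D]) (auto simp: comp_assoc)
qed

text \<open>The chain rule removes tangent vectors from the length: at all but finitely many times,
  \<open>carath_speed X \<gamma> t\<close> is \<open>carath_inf X (\<gamma> t) (velocity X \<gamma> t)\<close>.\<close>

definition carath_speed :: "('a, 'e::complex_finite_dim) cmanifold \<Rightarrow> (real \<Rightarrow> 'a) \<Rightarrow> real \<Rightarrow> ennreal" where
  "carath_speed X \<gamma> t = (SUP \<phi>\<in>disc_maps X. ennreal (cmod (vector_derivative (\<phi> \<circ> \<gamma>) (at t))))"

lemma carath_inf_velocity:
  assumes X: "complex_manifold X" and \<gamma>: "continuous_map (top_of_set {0..1}) (mtop X) \<gamma>"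
    and ab: "0 \<le> a" "b \<le> 1" and C1: "C1_on X a b \<gamma>" and t: "a < t" "t < b"
  shows "carath_inf X (\<gamma> t) (velocity X \<gamma> t) = carath_speed X \<gamma> t"
proof -
  have \<gamma>': "continuous_map (top_of_set {a..b}) (mtop X) \<gamma>"
    by (rule continuous_map_from_subtopology_mono[OF \<gamma>]) (use ab in auto)
  have w1: "at t within {0..1} = at t" and w2: "at t within {a..b} = at t"
    using t ab by (auto intro!: at_within_Icc_at)
  have p: "\<gamma> t \<in> points X"
    using continuous_map_image_subset_topspace[OF \<gamma>'] t by (auto simp: points_def)
  \<comment> \<open>The very choice made inside \<open>mderiv\<close>, so that its definition
    unfolds to the coordinates in this chart.\<close>
  define c where "c = (SOME c. c \<in> charts_at X (\<gamma> t))"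
  have "\<exists>c. c \<in> charts_at X (\<gamma> t)"
    using chart_around[OF X p] unfolding charts_at_def by (metis (mono_tags, lifting) fst_conv mem_Collect_eq)
  then have c: "c \<in> charts_at X (\<gamma> t)" unfolding c_def by (rule someI_ex)
  obtain U \<kappa> where cU: "c = (U, \<kappa>)" by (cases c)
  have U: "(U, \<kappa>) \<in> atlas X" "\<gamma> t \<in> U" using c unfolding cU charts_at_def by auto
  obtain d where d: "((\<kappa> \<circ> \<gamma>) has_vector_derivative d) (at t within {a..b})"
    using C1 U t unfolding C1_on_def by force
  have vel: "velocity X \<gamma> t (U, \<kappa>) = d"
    using c d unfolding cU velocity_def w1 w2 by (auto intro: vector_derivative_at)
  have "mderiv X \<phi> (\<gamma> t) (velocity X \<gamma> t) = vector_derivative (\<phi> \<circ> \<gamma>) (at t)"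
    if "\<phi> \<in> disc_maps X" for \<phi>
  proof -
    have "holo_coord X (points X) \<phi>" using that disc_maps_iff[OF X] by blast
    from chain_along_path[OF X \<gamma>' this U(1) _ U(2) p d] t
    show ?thesis
      unfolding mderiv_def c_def[symmetric] cU Let_def w2
      by (simp add: vel vector_derivative_at)
  qed
  then show ?thesis unfolding carath_inf_def carath_speed_def by simp
qed

section \<open>Lower integrals\<close>

text \<open>The speed of a path is a supremum of uncountably many functions. To avoid proving it measurable,
  the facts below are for arbitrary integrands, for which \<open>nn_integral\<close> is the lower integral.\<close>

lemma nn_integral_leI:
  assumes "\<And>g. g \<in> borel_measurable M \<Longrightarrow> g \<le> f \<Longrightarrow> integral\<^sup>N M g \<le> C"
  shows "integral\<^sup>N M f \<le> C"
  unfolding nn_integral_def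
proof (rule SUP_least, clarify)
  fix g assume g: "simple_function M g" "g \<le> f"
  show "integral\<^sup>S M g \<le> C"
    using assms[OF borel_measurable_simple_function[OF g(1)] g(2)]
    by (simp add: nn_integral_eq_simple_integral[OF g(1)])
qed

text \<open>Division by \<open>k\<close> turns a measurable minorant of the multiple into one of
  \<open>f\<close>.\<close>

lemma nn_integral_cmult_le:
  assumes "k > 0"
  shows "(\<integral>\<^sup>+x. ennreal k * f x \<partial>M) \<le> ennreal k * integral\<^sup>N M f"
proof (rule nn_integral_leI)
  fix g assume g[measurable]: "g \<in> borel_measurable M" and le: "g \<le> (\<lambda>x. ennreal k * f x)"
  have inv: "ennreal k * (ennreal (1 / k) * a) = a" "ennreal (1 / k) * (ennreal k * a) = a" for a
    using assms by (simp_all flip: mult.assoc ennreal_mult)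
  have "integral\<^sup>N M g = (\<integral>\<^sup>+x. ennreal k * (ennreal (1 / k) * g x) \<partial>M)"
    by (simp add: inv)
  also have "\<dots> = ennreal k * (\<integral>\<^sup>+x. ennreal (1 / k) * g x \<partial>M)"
    by (rule nn_integral_cmult) measurable
  also have "\<dots> \<le> ennreal k * integral\<^sup>N M f"
  proof (intro mult_left_mono nn_integral_mono)
    fix x
    have "ennreal (1 / k) * g x \<le> ennreal (1 / k) * (ennreal k * f x)"
      using le by (intro mult_left_mono) (auto simp: le_fun_def)
    then show "ennreal (1 / k) * g x \<le> f x" by (simp add: inv)
  qed simp
  finally show "integral\<^sup>N M g \<le> ennreal k * integral\<^sup>N M f" .
qed

text \<open>The substitution \<open>s = q + m * x\<close>, with Jacobian
  \<open>\<bar>m\<bar>\<close>, is carried out on measurable minorants and transports them to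
  minorants of \<open>f\<close>.\<close>

lemma nn_integral_affine_le:
  fixes f :: "real \<Rightarrow> ennreal"
  assumes "m \<noteq> 0"
  shows "(\<integral>\<^sup>+x. ennreal \<bar>m\<bar> * f (q + m * x) \<partial>lborel) \<le> integral\<^sup>N lborel f"
proof (rule nn_integral_leI)
  fix g :: "real \<Rightarrow> ennreal"
  assume g: "g \<in> borel_measurable lborel" and le: "g \<le> (\<lambda>x. ennreal \<bar>m\<bar> * f (q + m * x))"
  have [measurable]: "g \<in> borel_measurable borel" using g by simp
  have inv: "ennreal \<bar>m\<bar> * (ennreal (1 / \<bar>m\<bar>) * a) = a" "ennreal (1 / \<bar>m\<bar>) * (ennreal \<bar>m\<bar> * a) = a" for a
    using assms by (simp_all flip: mult.assoc ennreal_mult)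
  define g' where "g' = (\<lambda>s. ennreal (1 / \<bar>m\<bar>) * g ((s - q) / m))"
  have g'[measurable]: "g' \<in> borel_measurable borel" unfolding g'_def by measurable
  have "integral\<^sup>N lborel g = (\<integral>\<^sup>+x. ennreal \<bar>m\<bar> * g' (q + m * x) \<partial>lborel)"
    using assms by (simp add: g'_def inv)
  also have "\<dots> = ennreal \<bar>m\<bar> * (\<integral>\<^sup>+x. g' (q + m * x) \<partial>lborel)"
    by (rule nn_integral_cmult) measurable
  also have "\<dots> = integral\<^sup>N lborel g'"
    by (rule nn_integral_real_affine[symmetric]) (use assms in auto)
  also have "\<dots> \<le> integral\<^sup>N lborel f"
  proof (rule nn_integral_mono)
    fix s
    have "q + m * ((s - q) / m) = s" using assms by simp
    then have "g ((s - q) / m) \<le> ennreal \<bar>m\<bar> * f s"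
      using le_funD[OF le, of "(s - q) / m"] by simp
    then have "g' s \<le> ennreal (1 / \<bar>m\<bar>) * (ennreal \<bar>m\<bar> * f s)"
      unfolding g'_def by (intro mult_left_mono) auto
    then show "g' s \<le> f s" by (simp add: inv)
  qed
  finally show "integral\<^sup>N lborel g \<le> integral\<^sup>N lborel f" .
qed

text \<open>Minorants of \<open>f\<close> and \<open>g\<close> add up to a minorant of the sum. When
  the total is finite, subtraction allows the two suprema to be taken one after the other. For lower
  integrals the reverse inequality can fail.\<close>

lemma nn_integral_superadditive:
  "integral\<^sup>N M f + integral\<^sup>N M g \<le> (\<integral>\<^sup>+x. f x + g x \<partial>M)"
proof (cases "(\<integral>\<^sup>+x. f x + g x \<partial>M) = top")
  case False
  define J where "J = (\<integral>\<^sup>+x. f x + g x \<partial>M)"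
  have 1: "integral\<^sup>N M f' + integral\<^sup>N M g \<le> J" if f': "f' \<in> borel_measurable M" "f' \<le> f" for f'
  proof -
    have fin: "integral\<^sup>N M f' \<le> J" unfolding J_def
      using f'(2) by (intro nn_integral_mono) (auto simp: le_fun_def intro: add_increasing2)
    have "integral\<^sup>N M g \<le> J - integral\<^sup>N M f'"
    proof (rule nn_integral_leI)
      fix g' assume g': "g' \<in> borel_measurable M" "g' \<le> g"
      have "integral\<^sup>N M f' + integral\<^sup>N M g' = (\<integral>\<^sup>+x. f' x + g' x \<partial>M)"
        using f'(1) g'(1) by (rule nn_integral_add[symmetric])
      also have "\<dots> \<le> J" unfolding J_def
        using f'(2) g'(2) by (intro nn_integral_mono add_mono) (auto simp: le_fun_def)
      finally show "integral\<^sup>N M g' \<le> J - integral\<^sup>N M f'"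
        by (simp add: ennreal_le_minus_iff add.commute)
    qed
    then have "integral\<^sup>N M f' + integral\<^sup>N M g \<le> integral\<^sup>N M f' + (J - integral\<^sup>N M f')"
      by (rule add_left_mono)
    also have "\<dots> = J"
      using fin by (rule add_diff_inverse_ennreal)
    finally show ?thesis .
  qed
  have "integral\<^sup>N M g \<le> J" unfolding J_def by (intro nn_integral_mono) (simp add: add_increasing)
  moreover have "integral\<^sup>N M f \<le> J - integral\<^sup>N M g"
    by (rule nn_integral_leI) (use 1 in \<open>simp add: ennreal_le_minus_iff\<close>)
  ultimately have "integral\<^sup>N M g + integral\<^sup>N M f \<le> J"
    using add_left_mono[of "integral\<^sup>N M f" "J - integral\<^sup>N M g" "integral\<^sup>N M g"]
    by (simp add: add_diff_inverse_ennreal)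
  then show ?thesis by (simp add: J_def add.commute)
qed simp

text \<open>Equality holds in spite of the lower integral because the cut is made along measurable
  sets: a minorant can itself be cut at \<open>b\<close>. The opposite direction is superadditivity,
  with the doubly counted point \<open>b\<close> a null set.\<close>

lemma nn_integral_Icc_combine:
  fixes F :: "real \<Rightarrow> ennreal"
  assumes "a \<le> b" "b \<le> c"
  shows "(\<integral>\<^sup>+x\<in>{a..c}. F x \<partial>lborel) = (\<integral>\<^sup>+x\<in>{a..b}. F x \<partial>lborel) + (\<integral>\<^sup>+x\<in>{b..c}. F x \<partial>lborel)"
proof (rule antisym)
  show "(\<integral>\<^sup>+x\<in>{a..c}. F x \<partial>lborel) \<le> (\<integral>\<^sup>+x\<in>{a..b}. F x \<partial>lborel) + (\<integral>\<^sup>+x\<in>{b..c}. F x \<partial>lborel)"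
  proof (rule nn_integral_leI)
    fix g :: "real \<Rightarrow> ennreal"
    assume g: "g \<in> borel_measurable lborel" and le: "g \<le> (\<lambda>x. F x * indicator {a..c} x)"
    have [measurable]: "g \<in> borel_measurable borel" using g by simp
    have g0: "g x \<le> F x * indicator {a..c} x" for x using le by (simp add: le_fun_def)
    have "integral\<^sup>N lborel g = (\<integral>\<^sup>+x. g x * indicator {..b} x + g x * indicator {b<..} x \<partial>lborel)"
      by (rule nn_integral_cong) (auto split: split_indicator)
    also have "\<dots> = (\<integral>\<^sup>+x. g x * indicator {..b} x \<partial>lborel) + (\<integral>\<^sup>+x. g x * indicator {b<..} x \<partial>lborel)"
      by (rule nn_integral_add) measurable
    also have "\<dots> \<le> (\<integral>\<^sup>+x\<in>{a..b}. F x \<partial>lborel) + (\<integral>\<^sup>+x\<in>{b..c}. F x \<partial>lborel)"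
      using g0 by (intro add_mono nn_integral_mono) (force split: split_indicator split_indicator_asm)+
    finally show "integral\<^sup>N lborel g \<le> \<dots>" .
  qed
  have "(\<integral>\<^sup>+x\<in>{a..b}. F x \<partial>lborel) + (\<integral>\<^sup>+x\<in>{b..c}. F x \<partial>lborel)
      \<le> (\<integral>\<^sup>+x. F x * indicator {a..b} x + F x * indicator {b..c} x \<partial>lborel)"
    by (rule nn_integral_superadditive)
  also have "\<dots> \<le> (\<integral>\<^sup>+x\<in>{a..c}. F x \<partial>lborel)"
  proof (rule nn_integral_mono_AE)
    have "AE x in lborel. x \<notin> {b}"
      by (intro AE_not_in finite_imp_null_set_lborel) simp
    then show "AE x in lborel. F x * indicator {a..b} x + F x * indicator {b..c} x \<le> F x * indicator {a..c} x"
      by eventually_elim (use assms in \<open>auto split: split_indicator\<close>)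
  qed
  finally show "(\<integral>\<^sup>+x\<in>{a..b}. F x \<partial>lborel) + (\<integral>\<^sup>+x\<in>{b..c}. F x \<partial>lborel) \<le> (\<integral>\<^sup>+x\<in>{a..c}. F x \<partial>lborel)" .
qed

text \<open>The fundamental theorem of calculus for the continuous \<open>D\<close>, followed by
  comparison with \<open>F\<close>. The comparison is asked only at interior times, since speeds are
  two-sided derivatives; the end points form a null set.\<close>

lemma norm_diff_le_nn_integral:
  fixes u :: "real \<Rightarrow> 'b::euclidean_space"
  assumes "a \<le> b" and u: "\<And>s. s \<in> {a..b} \<Longrightarrow> (u has_vector_derivative D s) (at s within {a..b})"
    and D: "continuous_on {a..b} D" and le: "\<And>s. a < s \<Longrightarrow> s < b \<Longrightarrow> ennreal (norm (D s)) \<le> F s"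
  shows "ennreal (norm (u b - u a)) \<le> (\<integral>\<^sup>+s\<in>{a..b}. F s \<partial>lborel)"
proof -
  have int: "integrable lborel (\<lambda>s. indicator {a..b} s *\<^sub>R D s)"
    using borel_integrable_atLeastAtMost'[OF D] by (simp add: set_integrable_def)
  have "u b - u a = (\<integral>s. indicator {a..b} s *\<^sub>R D s \<partial>lborel)"
    using assms by (intro integral_FTC_atLeastAtMost[symmetric]) auto
  then have "ennreal (norm (u b - u a)) \<le> (\<integral>\<^sup>+s. ennreal (norm (indicator {a..b} s *\<^sub>R D s)) \<partial>lborel)"
    using integral_norm_bound_ennreal[OF int] by simp
  also have "\<dots> \<le> (\<integral>\<^sup>+s\<in>{a..b}. F s \<partial>lborel)"
  proof (rule nn_integral_mono_AE)
    have "AE x in lborel. x \<notin> {a, b}"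
      by (intro AE_not_in finite_imp_null_set_lborel) simp
    then show "AE s in lborel. ennreal (norm (indicator {a..b} s *\<^sub>R D s)) \<le> F s * indicator {a..b} s"
      by eventually_elim (use le in \<open>auto split: split_indicator\<close>)
  qed
  finally show ?thesis .
qed

section \<open>Piecewise smooth paths and their length\<close>

lemma C1_on_cong:
  assumes "C1_on X a b \<gamma>" and eq: "\<And>t. t \<in> {a..b} \<Longrightarrow> \<gamma> t = \<gamma>' t"
  shows "C1_on X a b \<gamma>'"
  unfolding C1_on_def
proof (intro ballI, clarify)
  fix U \<kappa> assume "(U, \<kappa>) \<in> atlas X"
  then obtain D where D: "continuous_on {s \<in> {a..b}. \<gamma> s \<in> U} D"
    "\<And>s. s \<in> {a..b} \<Longrightarrow> \<gamma> s \<in> U \<Longrightarrow> ((\<kappa> \<circ> \<gamma>) has_vector_derivative D s) (at s within {a..b})"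
    using assms(1) unfolding C1_on_def by blast
  have "{s \<in> {a..b}. \<gamma> s \<in> U} = {s \<in> {a..b}. \<gamma>' s \<in> U}" using eq by auto
  moreover have "((\<kappa> \<circ> \<gamma>') has_vector_derivative D s) (at s within {a..b})"
    if "s \<in> {a..b}" "\<gamma>' s \<in> U" for s
    by (rule has_vector_derivative_transform[OF that(1) _ D(2)]) (use eq that in auto)
  ultimately show "\<exists>D. continuous_on {s \<in> {a..b}. \<gamma>' s \<in> U} D \<and>
      (\<forall>s\<in>{a..b}. \<gamma>' s \<in> U \<longrightarrow> ((\<kappa> \<circ> \<gamma>') has_vector_derivative D s) (at s within {a..b}))"
    using D(1) by auto
qed

lemma C1_on_affine:
  assumes C1: "C1_on X c d \<gamma>" and sub: "\<And>t. t \<in> {a..b} \<Longrightarrow> q + m * t \<in> {c..d}"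
  shows "C1_on X a b (\<lambda>t. \<gamma> (q + m * t))"
  unfolding C1_on_def
proof (intro ballI, clarify)
  fix U \<kappa> assume "(U, \<kappa>) \<in> atlas X"
  then obtain D where D: "continuous_on {s \<in> {c..d}. \<gamma> s \<in> U} D"
    "\<And>s. s \<in> {c..d} \<Longrightarrow> \<gamma> s \<in> U \<Longrightarrow> ((\<kappa> \<circ> \<gamma>) has_vector_derivative D s) (at s within {c..d})"
    using C1 unfolding C1_on_def by blast
  have "continuous_on {s \<in> {a..b}. \<gamma> (q + m * s) \<in> U} (\<lambda>s. m *\<^sub>R D (q + m * s))"
    by (intro continuous_intros continuous_on_compose2[OF D(1)]) (use sub in auto)
  moreover have "((\<kappa> \<circ> (\<lambda>t. \<gamma> (q + m * t))) has_vector_derivative m *\<^sub>R D (q + m * s)) (at s within {a..b})"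
    if s: "s \<in> {a..b}" "\<gamma> (q + m * s) \<in> U" for s
  proof -
    have "((\<lambda>t. q + m * t) has_vector_derivative m) (at s within {a..b})"
      by (auto intro!: derivative_eq_intros)
    moreover have "((\<kappa> \<circ> \<gamma>) has_vector_derivative D (q + m * s)) (at (q + m * s) within (\<lambda>t. q + m * t) ` {a..b})"
      by (rule has_vector_derivative_within_subset[OF D(2)]) (use s sub in auto)
    ultimately show ?thesis
      using vector_diff_chain_within by (fastforce simp: comp_def)
  qed
  ultimately show "\<exists>D. continuous_on {s \<in> {a..b}. \<gamma> (q + m * s) \<in> U} D \<and>
      (\<forall>s\<in>{a..b}. \<gamma> (q + m * s) \<in> U \<longrightarrow>
        ((\<kappa> \<circ> (\<lambda>t. \<gamma> (q + m * t))) has_vector_derivative D s) (at s within {a..b}))"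
    by (intro exI[of _ "\<lambda>s. m *\<^sub>R D (q + m * s)"]) blast
qed

text \<open>Replaces the subdivision points in \<open>piecewise_C1_path\<close> by an induction
  principle. Free end points allow paths to be joined and reparametrized.\<close>

inductive pw_C1 :: "('a, 'e::complex_finite_dim) cmanifold \<Rightarrow> (real \<Rightarrow> 'a) \<Rightarrow> real \<Rightarrow> real \<Rightarrow> bool"
  for X \<gamma> where
  pw_C1_base: "a < b \<Longrightarrow> C1_on X a b \<gamma> \<Longrightarrow> pw_C1 X \<gamma> a b"
| pw_C1_step: "pw_C1 X \<gamma> a b \<Longrightarrow> b < c \<Longrightarrow> C1_on X b c \<gamma> \<Longrightarrow> pw_C1 X \<gamma> a c"

lemma pw_C1_less: "pw_C1 X \<gamma> a b \<Longrightarrow> a < b"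
  by (induction rule: pw_C1.induct) auto

lemma pw_C1_join: "pw_C1 X \<gamma> b c \<Longrightarrow> pw_C1 X \<gamma> a b \<Longrightarrow> pw_C1 X \<gamma> a c"
  by (induction rule: pw_C1.induct) (auto intro: pw_C1_step)

lemma pw_C1_cong: "pw_C1 X \<gamma> a b \<Longrightarrow> (\<And>t. t \<in> {a..b} \<Longrightarrow> \<gamma> t = \<gamma>' t) \<Longrightarrow> pw_C1 X \<gamma>' a b"
proof (induction rule: pw_C1.induct)
  case (pw_C1_base a b)
  then show ?case by (auto intro!: pw_C1.pw_C1_base intro: C1_on_cong)
next
  case (pw_C1_step a b c)
  have "a < b" using pw_C1_step.hyps(1) by (rule pw_C1_less)
  then show ?case
    using pw_C1_step by (intro pw_C1.pw_C1_step[of X \<gamma>' a b c]) (auto intro: C1_on_cong)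
qed

lemma affine_mem_Icc_pos:
  fixes m :: real
  assumes "m > 0" "t \<in> {(b - q) / m..(c - q) / m}"
  shows "q + m * t \<in> {b..c}"
  using assms by (simp add: pos_divide_le_eq pos_le_divide_eq algebra_simps)

lemma affine_mem_Icc_neg:
  fixes m :: real
  assumes "m < 0" "t \<in> {(c - q) / m..(b - q) / m}"
  shows "q + m * t \<in> {b..c}"
  using assms by (simp add: neg_divide_le_eq neg_le_divide_eq algebra_simps)

lemma pw_C1_affine_pos:
  assumes "pw_C1 X \<gamma> c d" and m: "m > 0"
  shows "pw_C1 X (\<lambda>t. \<gamma> (q + m * t)) ((c - q) / m) ((d - q) / m)"
  using assms(1)
proof (induction rule: pw_C1.induct)
  case (pw_C1_base a b)
  have "(a - q) / m < (b - q) / m"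
    using pw_C1_base(1) m by (simp add: divide_strict_right_mono)
  then show ?case
    using C1_on_affine[OF pw_C1_base(2) affine_mem_Icc_pos[OF m]] by (rule pw_C1.pw_C1_base)
next
  case (pw_C1_step a b c)
  have "(b - q) / m < (c - q) / m"
    using pw_C1_step(2) m by (simp add: divide_strict_right_mono)
  with pw_C1_step.IH show ?case
    using C1_on_affine[OF pw_C1_step(3) affine_mem_Icc_pos[OF m]] by (rule pw_C1.pw_C1_step)
qed

text \<open>A negative slope reverses the order of the pieces, so the piece added last comes first
  and has to be attached by \<open>pw_C1_join\<close>.\<close>

lemma pw_C1_affine_neg:
  assumes "pw_C1 X \<gamma> c d" and m: "m < 0"
  shows "pw_C1 X (\<lambda>t. \<gamma> (q + m * t)) ((d - q) / m) ((c - q) / m)"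
  using assms(1)
proof (induction rule: pw_C1.induct)
  case (pw_C1_base a b)
  have "(b - q) / m < (a - q) / m"
    using pw_C1_base(1) m by (simp add: divide_strict_right_mono_neg)
  then show ?case
    using C1_on_affine[OF pw_C1_base(2) affine_mem_Icc_neg[OF m]] by (rule pw_C1.pw_C1_base)
next
  case (pw_C1_step a b c)
  have "(c - q) / m < (b - q) / m"
    using pw_C1_step(2) m by (simp add: divide_strict_right_mono_neg)
  then have "pw_C1 X (\<lambda>t. \<gamma> (q + m * t)) ((c - q) / m) ((b - q) / m)"
    using C1_on_affine[OF pw_C1_step(3) affine_mem_Icc_neg[OF m]] by (rule pw_C1.pw_C1_base)
  with pw_C1_step.IH show ?case by (rule pw_C1_join)
qed

lemma piecewise_C1_path_iff:
  "piecewise_C1_path X x y \<gamma> \<longleftrightarrow>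
    continuous_map (top_of_set {0..1}) (mtop X) \<gamma> \<and> \<gamma> 0 = x \<and> \<gamma> 1 = y \<and> pw_C1 X \<gamma> 0 1"
proof -
  have steps: "pw_C1 X \<gamma> (p 0) (p (Suc n))"
    if "\<And>i. i < N \<Longrightarrow> p i < p (Suc i) \<and> C1_on X (p i) (p (Suc i)) \<gamma>" "Suc n \<le> N" for N n p
    using that(2)
  proof (induction n)
    case 0
    then show ?case using that(1)[of 0] by (auto intro: pw_C1_base)
  next
    case (Suc n)
    then show ?case using that(1)[of "Suc n"] by (auto intro: pw_C1_step)
  qed
  moreover have "\<exists>(N::nat) p. p 0 = a \<and> p N = b \<and> (\<forall>i<N. p i < p (Suc i) \<and> C1_on X (p i) (p (Suc i)) \<gamma>)"
    if "pw_C1 X \<gamma> a b" for a b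
    using that
  proof (induction rule: pw_C1.induct)
    case (pw_C1_base a b)
    then show ?case
      by (intro exI[of _ "1::nat"] exI[of _ "\<lambda>i::nat. if i = 0 then a else b"]) auto
  next
    case (pw_C1_step a b c)
    then obtain N :: nat and p where "p 0 = a" "p N = b" "\<forall>i<N. p i < p (Suc i) \<and> C1_on X (p i) (p (Suc i)) \<gamma>"
      by blast
    then show ?case
      using pw_C1_step.hyps
      by (intro exI[of _ "Suc N"] exI[of _ "p(Suc N := c)"]) (auto simp: less_Suc_eq)
  qed
  moreover have "pw_C1 X \<gamma> 0 1"
    if N: "p 0 = 0" "p N = 1" "\<forall>i<N. p i < p (Suc i) \<and> C1_on X (p i) (p (Suc i)) \<gamma>" for N :: nat and p
  proof -
    have "N \<noteq> 0" using N(1,2) by (metis zero_neq_one)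
    then obtain n where "N = Suc n" by (cases N) auto
    then show ?thesis using steps[of N p n] N by simp
  qed
  ultimately show ?thesis
    unfolding piecewise_C1_path_def pathin_def by blast
qed

text \<open>The triangle inequality along the subdivision matches additivity of the integral, so
  lower bounds for lengths need only be proved on smooth pieces. It is applied to a disc map along
  the path, and to a logarithm of one.\<close>

lemma pw_C1_norm_diff_le:
  fixes u :: "real \<Rightarrow> 'b::real_normed_vector" and F :: "real \<Rightarrow> ennreal"
  assumes "pw_C1 X \<gamma> a b"
    and "\<And>c d. a \<le> c \<Longrightarrow> c < d \<Longrightarrow> d \<le> b \<Longrightarrow> C1_on X c d \<gamma> \<Longrightarrow>
      ennreal (norm (u d - u c)) \<le> (\<integral>\<^sup>+t\<in>{c..d}. F t \<partial>lborel)"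
  shows "ennreal (norm (u b - u a)) \<le> (\<integral>\<^sup>+t\<in>{a..b}. F t \<partial>lborel)"
  using assms
proof (induction rule: pw_C1.induct)
  case (pw_C1_step a b c)
  have ab: "a < b" using pw_C1_step.hyps(1) by (rule pw_C1_less)
  have "norm (u c - u a) \<le> norm (u b - u a) + norm (u c - u b)"
    using norm_triangle_ineq[of "u b - u a" "u c - u b"] by simp
  then have "ennreal (norm (u c - u a)) \<le> ennreal (norm (u b - u a)) + ennreal (norm (u c - u b))"
    by (simp flip: ennreal_plus add: ennreal_leI)
  also have "\<dots> \<le> (\<integral>\<^sup>+t\<in>{a..b}. F t \<partial>lborel) + (\<integral>\<^sup>+t\<in>{b..c}. F t \<partial>lborel)"
    using pw_C1_step ab by (intro add_mono) auto
  also have "\<dots> = (\<integral>\<^sup>+t\<in>{a..c}. F t \<partial>lborel)"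
    using ab pw_C1_step.hyps(2) by (intro nn_integral_Icc_combine[symmetric]) auto
  finally show ?case .
qed simp

text \<open>Almost every time is interior to a smooth piece, which is where the pointwise
  comparisons of speeds hold.\<close>

lemma pw_C1_finite_corners:
  assumes "pw_C1 X \<gamma> a b"
  obtains S where "finite S"
    "\<And>t. t \<in> {a..b} - S \<Longrightarrow> \<exists>c d. a \<le> c \<and> c < t \<and> t < d \<and> d \<le> b \<and> C1_on X c d \<gamma>"
proof -
  have "\<exists>S. finite S \<and> (\<forall>t\<in>{a..b} - S. \<exists>c d. a \<le> c \<and> c < t \<and> t < d \<and> d \<le> b \<and> C1_on X c d \<gamma>)"
    using assms
  proof (induction rule: pw_C1.induct)
    case (pw_C1_base a b)
    then show ?case by (intro exI[of _ "{a, b}"]) force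
  next
    case (pw_C1_step a b c)
    have ab: "a < b" using pw_C1_step.hyps(1) by (rule pw_C1_less)
    obtain S where S: "finite S" "\<forall>t\<in>{a..b} - S. \<exists>c d. a \<le> c \<and> c < t \<and> t < d \<and> d \<le> b \<and> C1_on X c d \<gamma>"
      using pw_C1_step.IH by blast
    have "\<exists>c' d. a \<le> c' \<and> c' < t \<and> t < d \<and> d \<le> c \<and> C1_on X c' d \<gamma>"
      if t: "t \<in> {a..c} - (S \<union> {b, c})" for t
    proof (cases "t \<le> b")
      case True
      then have "t \<in> {a..b} - S" using t by auto
      then obtain c' d where "a \<le> c'" "c' < t" "t < d" "d \<le> b" "C1_on X c' d \<gamma>" using S(2) by blast
      then show ?thesis using pw_C1_step.hyps(2) by (intro exI[of _ c'] exI[of _ d]) simp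
    next
      case False
      then show ?thesis using t ab pw_C1_step.hyps by (intro exI[of _ b] exI[of _ c]) auto
    qed
    then show ?case using S(1) by (intro exI[of _ "S \<union> {b, c}"]) simp
  qed
  then show thesis using that by blast
qed

section \<open>Lengths under reparametrization\<close>

abbreviation speed_length :: "('a, 'e::complex_finite_dim) cmanifold \<Rightarrow> (real \<Rightarrow> 'a) \<Rightarrow> real \<Rightarrow> real \<Rightarrow> ennreal" where
  "speed_length X \<gamma> a b \<equiv> (\<integral>\<^sup>+t\<in>{a..b}. carath_speed X \<gamma> t \<partial>lborel)"

lemma disc_map_C1_on:
  assumes X: "complex_manifold X" and \<gamma>: "continuous_map (top_of_set {a..b}) (mtop X) \<gamma>"
    and "a < b" and C1: "C1_on X a b \<gamma>" and \<phi>: "\<phi> \<in> disc_maps X"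
  obtains D where "continuous_on {a..b} D"
    "\<And>s. s \<in> {a..b} \<Longrightarrow> ((\<phi> \<circ> \<gamma>) has_vector_derivative D s) (at s within {a..b})"
    "\<And>s. a < s \<Longrightarrow> s < b \<Longrightarrow> ((\<phi> \<circ> \<gamma>) has_vector_derivative D s) (at s)"
proof -
  have "holo_coord X (points X) \<phi>" using \<phi> disc_maps_iff[OF X] by blast
  then obtain D where D: "continuous_on {s \<in> {a..b}. \<gamma> s \<in> points X} D"
    "\<And>s. s \<in> {a..b} \<Longrightarrow> \<gamma> s \<in> points X \<Longrightarrow> ((\<phi> \<circ> \<gamma>) has_vector_derivative D s) (at s within {a..b})"
    using C1_on_holo_coord[OF X \<gamma> \<open>a < b\<close> C1] by blast
  have p: "\<gamma> s \<in> points X" if "s \<in> {a..b}" for s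
    using continuous_map_image_subset_topspace[OF \<gamma>] that by (auto simp: points_def)
  then have "{s \<in> {a..b}. \<gamma> s \<in> points X} = {a..b}" by blast
  moreover have "((\<phi> \<circ> \<gamma>) has_vector_derivative D s) (at s)" if "a < s" "s < b" for s
    using D(2)[of s] p[of s] that by (simp add: at_within_Icc_at)
  ultimately show thesis using that D p by simp
qed

lemma continuous_map_subinterval:
  fixes a b c d :: real
  assumes "continuous_map (top_of_set {a..b}) T \<gamma>" "a \<le> c" "d \<le> b"
  shows "continuous_map (top_of_set {c..d}) T \<gamma>"
  by (rule continuous_map_from_subtopology_mono[OF assms(1)]) (use assms(2,3) in auto)

lemma carath_length_eq_speed_length:
  assumes X: "complex_manifold X" and \<gamma>: "piecewise_C1_path X x y \<gamma>"
  shows "carath_length X \<gamma> = speed_length X \<gamma> 0 1"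
  unfolding carath_length_def
proof (rule nn_integral_cong_AE)
  have c: "continuous_map (top_of_set {0..1}) (mtop X) \<gamma>" and pw: "pw_C1 X \<gamma> 0 1"
    using \<gamma> by (simp_all add: piecewise_C1_path_iff)
  obtain S where S: "finite S"
    "\<And>t. t \<in> {0..1} - S \<Longrightarrow> \<exists>c d. 0 \<le> c \<and> c < t \<and> t < d \<and> d \<le> 1 \<and> C1_on X c d \<gamma>"
    using pw_C1_finite_corners[OF pw] by metis
  have "AE t in lborel. t \<notin> S"
    using S(1) by (intro AE_not_in finite_imp_null_set_lborel)
  then show "AE t in lborel. carath_inf X (\<gamma> t) (velocity X \<gamma> t) * indicator {0..1} t
      = carath_speed X \<gamma> t * indicator {0..1} t"
  proof eventually_elim
    case (elim t)
    then show ?case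
      using S(2)[of t] carath_inf_velocity[OF X c] by (cases "t \<in> {0..1}") auto
  qed
qed

lemma speed_length_affine_le:
  assumes X: "complex_manifold X" and \<gamma>: "continuous_map (top_of_set {c..d}) (mtop X) \<gamma>"
    and pw: "pw_C1 X \<gamma> c d" and m: "m \<noteq> 0"
    and sub: "\<And>t. t \<in> {a..b} \<Longrightarrow> q + m * t \<in> {c..d}"
    and eq: "\<And>t. t \<in> {a..b} \<Longrightarrow> \<gamma>' t = \<gamma> (q + m * t)"
  shows "speed_length X \<gamma>' a b \<le> speed_length X \<gamma> c d"
proof -
  obtain S where S: "finite S"
    "\<And>t. t \<in> {c..d} - S \<Longrightarrow> \<exists>c' d'. c \<le> c' \<and> c' < t \<and> t < d' \<and> d' \<le> d \<and> C1_on X c' d' \<gamma>"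
    using pw_C1_finite_corners[OF pw] by metis
  \<comment> \<open>Besides the preimages of the corners, the end points are excluded: \<gamma>' is
    known only on \<open>{a..b}\<close>, which does not determine its two-sided derivative
    there.\<close>
  define S' where "S' = {a, b} \<union> (\<lambda>s. (s - q) / m) ` S"
  have "finite S'" using S(1) by (simp add: S'_def)
  then have ae: "AE t in lborel. t \<notin> S'"
    by (intro AE_not_in finite_imp_null_set_lborel)
  have "carath_speed X \<gamma>' t \<le> ennreal \<bar>m\<bar> * carath_speed X \<gamma> (q + m * t)"
    if t: "t \<in> {a..b}" "t \<notin> S'" for t
    unfolding carath_speed_def[of X \<gamma>']
  proof (rule SUP_least)
    fix \<phi> assume \<phi>: "\<phi> \<in> disc_maps X"
    have "q + m * t \<notin> S"
      using t(2) m by (force simp: S'_def)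
    then obtain c' d' where cd: "c \<le> c'" "c' < q + m * t" "q + m * t < d'" "d' \<le> d" "C1_on X c' d' \<gamma>"
      using S(2)[of "q + m * t"] sub[OF t(1)] by blast
    have "c' < d'" using cd(2,3) by simp
    then obtain D0 where "\<And>s. c' < s \<Longrightarrow> s < d' \<Longrightarrow> ((\<phi> \<circ> \<gamma>) has_vector_derivative D0 s) (at s)"
      using disc_map_C1_on[OF X continuous_map_subinterval[OF \<gamma> cd(1,4)] _ cd(5) \<phi>] by metis
    then obtain D where D: "((\<phi> \<circ> \<gamma>) has_vector_derivative D) (at (q + m * t))"
      using cd(2,3) by blast
    have "((\<lambda>t. q + m * t) has_vector_derivative m) (at t)"
      by (auto intro!: derivative_eq_intros)
    from vector_diff_chain_at[OF this D]
    have "((\<lambda>t. \<phi> (\<gamma> (q + m * t))) has_vector_derivative m *\<^sub>R D) (at t)" by (simp add: comp_def)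
    then have "((\<phi> \<circ> \<gamma>') has_vector_derivative m *\<^sub>R D) (at t)"
      by (rule has_vector_derivative_transform_within_open[of _ _ _ "{a<..<b}"])
        (use t eq in \<open>auto simp: S'_def\<close>)
    then have "cmod (vector_derivative (\<phi> \<circ> \<gamma>') (at t)) = \<bar>m\<bar> * cmod (vector_derivative (\<phi> \<circ> \<gamma>) (at (q + m * t)))"
      using D by (simp add: vector_derivative_at)
    then have "ennreal (cmod (vector_derivative (\<phi> \<circ> \<gamma>') (at t)))
        = ennreal \<bar>m\<bar> * ennreal (cmod (vector_derivative (\<phi> \<circ> \<gamma>) (at (q + m * t))))"
      by (simp add: ennreal_mult)
    also have "\<dots> \<le> ennreal \<bar>m\<bar> * carath_speed X \<gamma> (q + m * t)"
      unfolding carath_speed_def by (intro mult_left_mono SUP_upper \<phi>) simp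
    finally show "ennreal (cmod (vector_derivative (\<phi> \<circ> \<gamma>') (at t))) \<le> \<dots>" .
  qed
  note speed_le = this
  have "speed_length X \<gamma>' a b
      \<le> (\<integral>\<^sup>+t. ennreal \<bar>m\<bar> * (carath_speed X \<gamma> (q + m * t) * indicator {c..d} (q + m * t)) \<partial>lborel)"
  proof (rule nn_integral_mono_AE)
    from ae show "AE t in lborel. carath_speed X \<gamma>' t * indicator {a..b} t
        \<le> ennreal \<bar>m\<bar> * (carath_speed X \<gamma> (q + m * t) * indicator {c..d} (q + m * t))"
    proof eventually_elim
      case (elim t)
      then show ?case using speed_le[of t] sub[of t] by (cases "t \<in> {a..b}") auto
    qed
  qed
  also have "\<dots> \<le> speed_length X \<gamma> c d"
    using m by (rule nn_integral_affine_le)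
  finally show ?thesis .
qed

section \<open>Symmetry and triangle inequality of the integrated pseudodistance\<close>

lemma int_carath_le:
  assumes "complex_manifold X" "piecewise_C1_path X x y \<gamma>"
  shows "int_carath X x y \<le> speed_length X \<gamma> 0 1"
  using assms unfolding int_carath_def
  by (subst carath_length_eq_speed_length[symmetric]) (auto intro: INF_lower)

lemma int_carath_geI:
  assumes X: "complex_manifold X" and "\<And>\<gamma>. piecewise_C1_path X x y \<gamma> \<Longrightarrow> C \<le> speed_length X \<gamma> 0 1"
  shows "C \<le> int_carath X x y"
  using assms unfolding int_carath_def
  by (auto intro!: INF_greatest simp: carath_length_eq_speed_length)

lemma int_carath_reverse_le:
  assumes X: "complex_manifold X"
  shows "int_carath X y x \<le> int_carath X x y"
proof (rule int_carath_geI[OF X])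
  fix \<gamma> assume "piecewise_C1_path X x y \<gamma>"
  then have c: "continuous_map (top_of_set {0..1}) (mtop X) \<gamma>" and xy: "\<gamma> 0 = x" "\<gamma> 1 = y"
    and pw: "pw_C1 X \<gamma> 0 1"
    by (simp_all add: piecewise_C1_path_iff)
  define \<gamma>' where "\<gamma>' = (\<lambda>t. \<gamma> (1 + (-1) * t))"
  have "continuous_map (top_of_set {0..1}) (top_of_set {0..1}) (\<lambda>t::real. 1 + (-1) * t)"
    by (auto intro!: continuous_intros simp: continuous_map_in_subtopology)
  from continuous_map_compose[OF this c]
  have "continuous_map (top_of_set {0..1}) (mtop X) \<gamma>'" by (simp add: \<gamma>'_def comp_def)
  moreover have "pw_C1 X \<gamma>' 0 1"
    using pw_C1_affine_neg[OF pw, of "-1" 1] by (simp add: \<gamma>'_def)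
  ultimately have "piecewise_C1_path X y x \<gamma>'"
    unfolding piecewise_C1_path_iff using xy by (simp add: \<gamma>'_def)
  from int_carath_le[OF X this] have "int_carath X y x \<le> speed_length X \<gamma>' 0 1" .
  also have "\<dots> \<le> speed_length X \<gamma> 0 1"
    by (rule speed_length_affine_le[OF X c pw, of "-1" _ _ 1]) (auto simp: \<gamma>'_def)
  finally show "int_carath X y x \<le> speed_length X \<gamma> 0 1" .
qed

lemma int_carath_commute:
  "complex_manifold X \<Longrightarrow> int_carath X x y = int_carath X y x"
  by (intro antisym int_carath_reverse_le)

lemma int_carath_triangle:
  assumes X: "complex_manifold X"
  shows "int_carath X x z \<le> int_carath X x y + int_carath X y z"
proof -
  have main: "int_carath X x z \<le> speed_length X \<gamma> 0 1 + speed_length X \<delta> 0 1"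
    if \<gamma>: "piecewise_C1_path X x y \<gamma>" and \<delta>: "piecewise_C1_path X y z \<delta>" for \<gamma> \<delta>
  proof -
    have c: "continuous_map (top_of_set {0..1}) (mtop X) \<gamma>" "\<gamma> 0 = x" "\<gamma> 1 = y" "pw_C1 X \<gamma> 0 1"
      using \<gamma> by (simp_all add: piecewise_C1_path_iff)
    have d: "continuous_map (top_of_set {0..1}) (mtop X) \<delta>" "\<delta> 0 = y" "\<delta> 1 = z" "pw_C1 X \<delta> 0 1"
      using \<delta> by (simp_all add: piecewise_C1_path_iff)
    \<comment> \<open>Concatenation at double speed. The summand 0 is kept so that both halves have
      the shape \<open>q + m * t\<close> of the affine lemmas.\<close>
    define \<eta> where "\<eta> = (\<lambda>t. if t \<le> 1 / 2 then \<gamma> (0 + 2 * t) else \<delta> (-1 + 2 * t))"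
    have eq1: "\<eta> t = \<gamma> (0 + 2 * t)" if "t \<in> {0..1/2}" for t
      using that by (simp add: \<eta>_def)
    have eq2: "\<eta> t = \<delta> (-1 + 2 * t)" if "t \<in> {1/2..1}" for t
    proof (cases "t = 1 / 2")
      case True
      show ?thesis unfolding \<eta>_def True using c(3) d(2) by simp
    qed (use that in \<open>simp add: \<eta>_def\<close>)
    have "continuous_map (top_of_set {0..1}) (mtop X) \<eta>"
      unfolding \<eta>_def
    proof (rule continuous_map_cases_le)
      have "continuous_map (top_of_set {0..1/2}) (top_of_set {0..1}) (\<lambda>t::real. 0 + 2 * t)"
        by (auto intro!: continuous_intros simp: continuous_map_in_subtopology)
      from continuous_map_compose[OF this c(1)]
      show "continuous_map (subtopology (top_of_set {0..1}) {t \<in> topspace (top_of_set {0..1}). t \<le> 1/2}) (mtop X) (\<lambda>t. \<gamma> (0 + 2 * t))"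
        unfolding subtopology_subtopology
        by (rule continuous_map_eq[OF continuous_map_from_subtopology_mono]) auto
      have "continuous_map (top_of_set {1/2..1}) (top_of_set {0..1}) (\<lambda>t::real. -1 + 2 * t)"
        by (auto intro!: continuous_intros simp: continuous_map_in_subtopology)
      from continuous_map_compose[OF this d(1)]
      show "continuous_map (subtopology (top_of_set {0..1}) {t \<in> topspace (top_of_set {0..1}). 1/2 \<le> t}) (mtop X) (\<lambda>t. \<delta> (-1 + 2 * t))"
        unfolding subtopology_subtopology
        by (rule continuous_map_eq[OF continuous_map_from_subtopology_mono]) auto
      show "\<gamma> (0 + 2 * t) = \<delta> (-1 + 2 * t)" if "t = 1 / 2" for t
        unfolding that using c(3) d(2) by simp
    qed (auto simp: continuous_map_from_subtopology)
    moreover have "pw_C1 X \<eta> 0 1"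
    proof (rule pw_C1_join)
      have "pw_C1 X (\<lambda>t. \<delta> (-1 + 2 * t)) (1/2) 1"
        using pw_C1_affine_pos[OF d(4), of 2 "-1"] by simp
      then show "pw_C1 X \<eta> (1/2) 1" by (rule pw_C1_cong) (rule eq2[symmetric])
      have "pw_C1 X (\<lambda>t. \<gamma> (0 + 2 * t)) 0 (1/2)"
        using pw_C1_affine_pos[OF c(4), of 2 0] by simp
      then show "pw_C1 X \<eta> 0 (1/2)" by (rule pw_C1_cong) (rule eq1[symmetric])
    qed
    moreover have "\<eta> 0 = x" "\<eta> 1 = z" using c d by (simp_all add: \<eta>_def)
    ultimately have "int_carath X x z \<le> speed_length X \<eta> 0 1"
      by (intro int_carath_le[OF X]) (simp add: piecewise_C1_path_iff)
    also have "\<dots> = speed_length X \<eta> 0 (1/2) + speed_length X \<eta> (1/2) 1"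
      by (rule nn_integral_Icc_combine) auto
    also have "\<dots> \<le> speed_length X \<gamma> 0 1 + speed_length X \<delta> 0 1"
      by (intro add_mono speed_length_affine_le[OF X c(1,4) _ _ eq1] speed_length_affine_le[OF X d(1,4) _ _ eq2]) auto
    finally show ?thesis .
  qed
  \<comment> \<open>The two infima over paths are taken one at a time, by moving the other term
    across by subtraction; in \<open>ennreal\<close> this calls for finite values, so infinite ones
    are split off.\<close>
  show ?thesis
  proof (cases "int_carath X x y = top \<or> int_carath X y z = top")
    case False
    have "int_carath X x z \<le> speed_length X \<gamma> 0 1 + int_carath X y z"
      if \<gamma>: "piecewise_C1_path X x y \<gamma>" for \<gamma>
    proof (cases "speed_length X \<gamma> 0 1 = top")
      case fin: False
      have "int_carath X x z - speed_length X \<gamma> 0 1 \<le> int_carath X y z"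
        using main[OF \<gamma>] fin by (intro int_carath_geI[OF X]) (simp add: ennreal_minus_le_iff)
      then show ?thesis using fin by (simp add: ennreal_minus_le_iff)
    qed simp
    then have "int_carath X x z - int_carath X y z \<le> int_carath X x y"
      using False by (intro int_carath_geI[OF X]) (simp add: ennreal_minus_le_iff add.commute)
    then show ?thesis using False by (simp add: ennreal_minus_le_iff add.commute)
  qed auto
qed

section \<open>Comparison with the hyperbolic metric\<close>

text \<open>The derivative, at \<open>w\<close>, of the disc automorphism sending \<open>w\<close>
  to 0 is the hyperbolic density at \<open>w\<close>.\<close>

lemma Moebius_function_DERIV_self:
  assumes "cmod w < 1"
  shows "(Moebius_function 0 w has_field_derivative of_real (1 / (1 - (cmod w)\<^sup>2))) (at w)"
proof -
  have w: "cnj w * w = of_real ((cmod w)\<^sup>2)"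
    by (metis complex_norm_square mult.commute)
  have "(cmod w)\<^sup>2 < 1" using assms by (simp add: abs_square_less_1)
  then have nz: "1 - cnj w * w \<noteq> 0"
    unfolding w by (metis less_irrefl of_real_1 of_real_eq_iff right_minus_eq)
  have "((\<lambda>z. (z - w) / (1 - cnj w * z)) has_field_derivative 1 / (1 - cnj w * w)) (at w)"
    by (rule derivative_eq_intros refl nz)+ (use nz in simp)
  moreover have "1 / (1 - cnj w * w) = of_real (1 / (1 - (cmod w)\<^sup>2))"
    unfolding w by simp
  moreover have "Moebius_function 0 w = (\<lambda>z. (z - w) / (1 - cnj w * z))"
    by (rule ext) (rule Moebius_function_simple)
  ultimately show ?thesis by simp
qed

lemma disc_maps_Moebius:
  assumes "complex_manifold X" "\<phi> \<in> disc_maps X" "cmod w < 1"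
  shows "(\<lambda>x. Moebius_function 0 w (\<phi> x)) \<in> disc_maps X"
  using assms(1,2)
proof (rule disc_maps_compose_holomorphic)
  show "Moebius_function 0 w holomorphic_on ball 0 1"
    using assms(3) by (rule Moebius_function_holomorphic)
  show "cmod (Moebius_function 0 w z) < 1" if "cmod z < 1" for z
    using assms(3) that by (rule Moebius_function_norm_lt_1)
qed

lemma disc_mapsD: "complex_manifold X \<Longrightarrow> \<phi> \<in> disc_maps X \<Longrightarrow> x \<in> points X \<Longrightarrow> cmod (\<phi> x) < 1"
  by (simp add: disc_maps_iff)

lemma carath_speed_ge:
  assumes \<phi>: "\<phi> \<in> disc_maps X" and d: "((\<phi> \<circ> \<gamma>) has_vector_derivative d) (at t)"
  shows "ennreal (cmod d) \<le> carath_speed X \<gamma> t"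
  unfolding carath_speed_def
  by (rule SUP_upper2[OF \<phi>]) (simp add: vector_derivative_at[OF d])

lemma has_vector_derivative_Moebius:
  assumes d: "((\<phi> \<circ> \<gamma>) has_vector_derivative d) (at t)" and w: "cmod (\<phi> (\<gamma> t)) < 1"
  shows "(((\<lambda>x. Moebius_function 0 (\<phi> (\<gamma> t)) (\<phi> x)) \<circ> \<gamma>) has_vector_derivative
    d * of_real (1 / (1 - (cmod (\<phi> (\<gamma> t)))\<^sup>2))) (at t)"
  using field_vector_diff_chain_at[OF d Moebius_function_DERIV_self[OF w, folded comp_apply[of \<phi> \<gamma>]]]
  unfolding comp_def .

text \<open>The supremum also ranges over \<phi> followed by the automorphism sending
  \<open>\<phi> (\<gamma> t)\<close> to 0, and that composition multiplies the derivative at time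
  \<open>t\<close> by the hyperbolic density.\<close>

lemma carath_speed_ge_hyperbolic:
  assumes X: "complex_manifold X" and \<phi>: "\<phi> \<in> disc_maps X"
    and d: "((\<phi> \<circ> \<gamma>) has_vector_derivative d) (at t)" and t: "\<gamma> t \<in> points X"
  shows "ennreal (cmod d / (1 - (cmod (\<phi> (\<gamma> t)))\<^sup>2)) \<le> carath_speed X \<gamma> t"
proof -
  have w: "cmod (\<phi> (\<gamma> t)) < 1" using disc_mapsD[OF X \<phi> t] .
  then have "(cmod (\<phi> (\<gamma> t)))\<^sup>2 < 1" by (simp add: abs_square_less_1)
  then have "cmod (d * of_real (1 / (1 - (cmod (\<phi> (\<gamma> t)))\<^sup>2))) = cmod d / (1 - (cmod (\<phi> (\<gamma> t)))\<^sup>2)"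
    unfolding norm_mult norm_of_real by simp
  with carath_speed_ge[OF disc_maps_Moebius[OF X \<phi> w] has_vector_derivative_Moebius[OF d w]]
  show ?thesis by simp
qed

text \<open>Every disc map is itself a competitor in the speed, so its increment along a path is at
  most the length. Hence points at integrated distance 0 are not separated by disc maps.\<close>

lemma disc_map_diff_le_int_carath:
  assumes X: "complex_manifold X" and \<phi>: "\<phi> \<in> disc_maps X"
  shows "ennreal (cmod (\<phi> y - \<phi> x)) \<le> int_carath X x y"
proof (rule int_carath_geI[OF X])
  fix \<gamma> assume "piecewise_C1_path X x y \<gamma>"
  then have c: "continuous_map (top_of_set {0..1}) (mtop X) \<gamma>" and xy: "\<gamma> 0 = x" "\<gamma> 1 = y"
    and pw: "pw_C1 X \<gamma> 0 1"
    by (simp_all add: piecewise_C1_path_iff)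
  have "ennreal (cmod ((\<phi> \<circ> \<gamma>) b - (\<phi> \<circ> \<gamma>) a)) \<le> speed_length X \<gamma> a b"
    if ab: "0 \<le> a" "a < b" "b \<le> 1" "C1_on X a b \<gamma>" for a b
  proof -
    obtain D where D: "continuous_on {a..b} D"
      "\<And>s. s \<in> {a..b} \<Longrightarrow> ((\<phi> \<circ> \<gamma>) has_vector_derivative D s) (at s within {a..b})"
      "\<And>s. a < s \<Longrightarrow> s < b \<Longrightarrow> ((\<phi> \<circ> \<gamma>) has_vector_derivative D s) (at s)"
      using disc_map_C1_on[OF X continuous_map_subinterval[OF c ab(1,3)] ab(2,4) \<phi>] by metis
    show ?thesis
      by (rule norm_diff_le_nn_integral[OF less_imp_le[OF ab(2)] D(2,1) carath_speed_ge[OF \<phi> D(3)]])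
  qed
  from pw_C1_norm_diff_le[OF pw this] show "ennreal (cmod (\<phi> y - \<phi> x)) \<le> speed_length X \<gamma> 0 1"
    by (simp add: xy)
qed

lemma has_vector_derivative_one_minus_inner_self:
  assumes "(p has_vector_derivative d) (at s within S)"
  shows "((\<lambda>s. 1 - p s \<bullet> p s) has_vector_derivative - (2 * (p s \<bullet> d))) (at s within S)"
  using assms unfolding has_vector_derivative_def
  by (auto intro!: derivative_eq_intros simp: inner_commute algebra_simps)

text \<open>The function \<open>- ln (1 - |z|\<^sup>2) / 2\<close> is smooth on the disc, unlike the Poincare distance to
  the centre, and its gradient is bounded by the hyperbolic density \<open>1 / (1 - |z|\<^sup>2)\<close>.\<close>

lemma disc_map_ln_diff_le_int_carath:
  assumes X: "complex_manifold X" and \<phi>: "\<phi> \<in> disc_maps X"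
  shows "ennreal (\<bar>ln (1 - (cmod (\<phi> x))\<^sup>2) - ln (1 - (cmod (\<phi> y))\<^sup>2)\<bar> / 2) \<le> int_carath X x y"
proof (rule int_carath_geI[OF X])
  fix \<gamma> assume "piecewise_C1_path X x y \<gamma>"
  then have c: "continuous_map (top_of_set {0..1}) (mtop X) \<gamma>" and xy: "\<gamma> 0 = x" "\<gamma> 1 = y"
    and pw: "pw_C1 X \<gamma> 0 1"
    by (simp_all add: piecewise_C1_path_iff)
  define u where "u = (\<lambda>t. - ln (1 - (\<phi> \<circ> \<gamma>) t \<bullet> (\<phi> \<circ> \<gamma>) t) / 2)"
  have "ennreal (norm (u b - u a)) \<le> speed_length X \<gamma> a b"
    if ab: "0 \<le> a" "a < b" "b \<le> 1" "C1_on X a b \<gamma>" for a b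
  proof -
    have c': "continuous_map (top_of_set {a..b}) (mtop X) \<gamma>"
      using continuous_map_subinterval[OF c ab(1,3)] .
    obtain D where D: "continuous_on {a..b} D"
      "\<And>s. s \<in> {a..b} \<Longrightarrow> ((\<phi> \<circ> \<gamma>) has_vector_derivative D s) (at s within {a..b})"
      "\<And>s. a < s \<Longrightarrow> s < b \<Longrightarrow> ((\<phi> \<circ> \<gamma>) has_vector_derivative D s) (at s)"
      using disc_map_C1_on[OF X c' ab(2,4) \<phi>] by metis
    have p: "\<gamma> s \<in> points X" if "s \<in> {a..b}" for s
      using continuous_map_image_subset_topspace[OF c'] that by (auto simp: points_def)
    have pos: "1 - (\<phi> \<circ> \<gamma>) s \<bullet> (\<phi> \<circ> \<gamma>) s > 0" if "s \<in> {a..b}" for s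
      using disc_mapsD[OF X \<phi> p[OF that]]
      by (simp add: power2_norm_eq_inner[symmetric] abs_square_less_1)
    define E where "E = (\<lambda>s. ((\<phi> \<circ> \<gamma>) s \<bullet> D s) / (1 - (\<phi> \<circ> \<gamma>) s \<bullet> (\<phi> \<circ> \<gamma>) s))"
    show ?thesis
    proof (rule norm_diff_le_nn_integral[where D=E])
      show "a \<le> b" using ab by simp
      have cont: "continuous_on {a..b} (\<phi> \<circ> \<gamma>)"
        using D(2) by (rule continuous_on_vector_derivative)
      show "continuous_on {a..b} E"
        unfolding E_def by (intro continuous_intros cont D(1)) (use pos in force)
      show "(u has_vector_derivative E s) (at s within {a..b})" if s: "s \<in> {a..b}" for s
      proof -
        have "((\<lambda>s. 1 - (\<phi> \<circ> \<gamma>) s \<bullet> (\<phi> \<circ> \<gamma>) s) has_real_derivative - (2 * ((\<phi> \<circ> \<gamma>) s \<bullet> D s))) (at s within {a..b})"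
          using has_vector_derivative_one_minus_inner_self[OF D(2)[OF s]]
          unfolding has_real_derivative_iff_has_vector_derivative .
        note q = this
        have "(u has_real_derivative - (1 / (1 - (\<phi> \<circ> \<gamma>) s \<bullet> (\<phi> \<circ> \<gamma>) s) * - (2 * ((\<phi> \<circ> \<gamma>) s \<bullet> D s))) / 2) (at s within {a..b})"
          unfolding u_def
          by (rule DERIV_cdivide[OF DERIV_minus[OF DERIV_chain2[OF DERIV_ln_divide[OF pos[OF s]] q]]])
        note * = this
        have calc: "- (1 / q * - (2 * m)) / 2 = m / q" for q m :: real by simp
        have "- (1 / (1 - (\<phi> \<circ> \<gamma>) s \<bullet> (\<phi> \<circ> \<gamma>) s) * - (2 * ((\<phi> \<circ> \<gamma>) s \<bullet> D s))) / 2 = E s"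
          unfolding E_def using calc .
        with * have "(u has_real_derivative E s) (at s within {a..b})" by (simp only:)
        then show ?thesis by (simp add: has_real_derivative_iff_has_vector_derivative)
      qed
      fix s assume s: "a < s" "s < b"
      then have s': "s \<in> {a..b}" by simp
      \<comment> \<open>The numerator of \<open>E s\<close> is an inner product with a point of the
        disc, so Cauchy-Schwarz bounds \<open>E s\<close> by the hyperbolic speed of the image
        path.\<close>
      have "\<bar>(\<phi> \<circ> \<gamma>) s \<bullet> D s\<bar> \<le> cmod ((\<phi> \<circ> \<gamma>) s) * cmod (D s)"
        by (rule Cauchy_Schwarz_ineq2)
      also have "\<dots> \<le> 1 * cmod (D s)"
        using disc_mapsD[OF X \<phi> p[OF s']] by (intro mult_right_mono) auto
      finally have "norm (E s) \<le> cmod (D s) / (1 - (cmod (\<phi> (\<gamma> s)))\<^sup>2)"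
        using pos[OF s'] unfolding E_def
        by (simp add: power2_norm_eq_inner divide_right_mono)
      also have "ennreal \<dots> \<le> carath_speed X \<gamma> s"
        by (rule carath_speed_ge_hyperbolic[OF X \<phi> D(3)[OF s] p[OF s']])
      finally show "ennreal (norm (E s)) \<le> carath_speed X \<gamma> s"
        by (simp add: ennreal_leI)
    qed
  qed
  from pw_C1_norm_diff_le[OF pw this]
  have "ennreal (norm (u 1 - u 0)) \<le> speed_length X \<gamma> 0 1" .
  moreover have "u t = - ln (1 - (cmod (\<phi> (\<gamma> t)))\<^sup>2) / 2" for t
    by (simp add: u_def power2_norm_eq_inner)
  then have "u 1 - u 0 = (ln (1 - (cmod (\<phi> x))\<^sup>2) - ln (1 - (cmod (\<phi> y))\<^sup>2)) / 2"
    by (simp add: xy field_simps)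
  then have "norm (u 1 - u 0) = \<bar>ln (1 - (cmod (\<phi> x))\<^sup>2) - ln (1 - (cmod (\<phi> y))\<^sup>2)\<bar> / 2"
    by (simp only: real_norm_def abs_divide abs_numeral)
  ultimately show "ennreal (\<bar>ln (1 - (cmod (\<phi> x))\<^sup>2) - ln (1 - (cmod (\<phi> y))\<^sup>2)\<bar> / 2) \<le> speed_length X \<gamma> 0 1"
    by (simp only:)
qed

text \<open>The hypothesis \<open>K\<close> concerns only maps vanishing at a point of the image,
  since no \<open>k < 1\<close> could serve all disc maps. An arbitrary \<phi> is first moved by an
  automorphism to vanish at \<open>f (\<gamma> t)\<close>, and the automorphism changes with
  \<open>t\<close> while \<open>k\<close> does not.\<close>

lemma carath_speed_contract:
  assumes X: "complex_manifold X" and f: "holomorphic_map X X f" and k: "k > 0"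
    and K: "\<And>\<phi> p q. \<phi> \<in> disc_maps X \<Longrightarrow> p \<in> points X \<Longrightarrow> q \<in> points X \<Longrightarrow>
      \<phi> (f p) = 0 \<Longrightarrow> cmod (\<phi> (f q)) < k"
    and \<gamma>: "continuous_map (top_of_set {a..b}) (mtop X) \<gamma>" and C1: "C1_on X a b \<gamma>"
    and t: "a < t" "t < b"
  shows "carath_speed X (f \<circ> \<gamma>) t \<le> ennreal k * carath_speed X \<gamma> t"
  unfolding carath_speed_def[of X "f \<circ> \<gamma>"]
proof (rule SUP_least)
  fix \<phi> assume \<phi>: "\<phi> \<in> disc_maps X"
  have cf: "continuous_map (mtop X) (mtop X) f" using f by (simp add: holomorphic_map_def)
  have p: "\<gamma> t \<in> points X"
    using continuous_map_image_subset_topspace[OF \<gamma>] t by (auto simp: points_def)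
  have fp: "f (\<gamma> t) \<in> points X"
    using continuous_map_image_subset_topspace[OF cf] p by (auto simp: points_def)
  define w where "w = \<phi> (f (\<gamma> t))"
  have w: "cmod w < 1" unfolding w_def using disc_mapsD[OF X \<phi> fp] .
  then have w2: "0 < 1 - (cmod w)\<^sup>2" "1 - (cmod w)\<^sup>2 \<le> 1" by (simp_all add: abs_square_less_1)
  define \<phi>1 where "\<phi>1 = (\<lambda>x. Moebius_function 0 w (\<phi> x))"
  have \<phi>1: "\<phi>1 \<in> disc_maps X" unfolding \<phi>1_def by (rule disc_maps_Moebius[OF X \<phi> w])
  have "\<phi>1 (f (\<gamma> t)) = 0" by (simp add: \<phi>1_def w_def Moebius_function_eq_zero)
  then have "cmod (\<phi>1 (f q)) < k" if "q \<in> points X" for q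
    using K[OF \<phi>1 p that] by simp
  then have \<phi>2: "(\<lambda>x. \<phi>1 (f x) / of_real k) \<in> disc_maps X"
    using disc_maps_scaled_compose_map[OF X X f \<phi>1 k] by blast
  have "a < b" using t by simp
  then obtain D where "\<And>s. a < s \<Longrightarrow> s < b \<Longrightarrow> ((\<phi> \<circ> f \<circ> \<gamma>) has_vector_derivative D s) (at s)"
    using disc_map_C1_on[OF X \<gamma> _ C1 disc_maps_compose_map[OF X X f \<phi>]] by metis
  then have d: "((\<phi> \<circ> (f \<circ> \<gamma>)) has_vector_derivative D t) (at t)"
    using t by (simp add: comp_assoc)
  have "cmod ((\<phi> ((f \<circ> \<gamma>) t))) < 1" using w by (simp add: w_def)
  from has_vector_derivative_Moebius[OF d this]
  have "((\<phi>1 \<circ> (f \<circ> \<gamma>)) has_vector_derivative D t * of_real (1 / (1 - (cmod w)\<^sup>2))) (at t)"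
    unfolding \<phi>1_def w_def comp_apply .
  from has_vector_derivative_divide[OF this, of "of_real k"]
  have "(((\<lambda>x. \<phi>1 (f x) / of_real k) \<circ> \<gamma>) has_vector_derivative D t * of_real (1 / (1 - (cmod w)\<^sup>2)) / of_real k) (at t)"
    unfolding comp_def .
  from carath_speed_ge[OF \<phi>2 this]
  have *: "ennreal (cmod (D t * of_real (1 / (1 - (cmod w)\<^sup>2)) / of_real k)) \<le> carath_speed X \<gamma> t" .
  have eq: "cmod (D t * of_real (1 / (1 - (cmod w)\<^sup>2)) / of_real k) = cmod (D t) / (1 - (cmod w)\<^sup>2) / k"
    unfolding norm_mult norm_divide norm_of_real using k w2 by simp
  \<comment> \<open>Normalising costs nothing: the automorphism has derivative at least 1 in modulus
    at \<open>w\<close>.\<close>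
  have "cmod (D t) \<le> cmod (D t) / (1 - (cmod w)\<^sup>2)"
    using w2 by (simp add: pos_le_divide_eq mult_left_le)
  also have "\<dots> = k * (cmod (D t) / (1 - (cmod w)\<^sup>2) / k)" using k by simp
  also have "ennreal \<dots> = ennreal k * ennreal (cmod (D t) / (1 - (cmod w)\<^sup>2) / k)"
    using k w2 by (intro ennreal_mult) auto
  also have "\<dots> \<le> ennreal k * carath_speed X \<gamma> t"
    using * unfolding eq by (rule mult_left_mono) simp
  finally have "ennreal (cmod (D t)) \<le> ennreal k * carath_speed X \<gamma> t"
    by (simp add: ennreal_leI)
  then show "ennreal (cmod (vector_derivative (\<phi> \<circ> (f \<circ> \<gamma>)) (at t))) \<le> ennreal k * carath_speed X \<gamma> t"
    by (simp add: vector_derivative_at[OF d])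
qed

lemma pw_C1_compose_map:
  assumes "pw_C1 X \<gamma> a b" and X: "complex_manifold X" and Y: "complex_manifold Y"
    and f: "holomorphic_map X Y f" and "continuous_map (top_of_set {a..b}) (mtop X) \<gamma>"
  shows "pw_C1 Y (f \<circ> \<gamma>) a b"
  using assms(1,5)
proof (induction rule: pw_C1.induct)
  case (pw_C1_base a b)
  then show ?case by (intro pw_C1.pw_C1_base C1_on_compose_map[OF X Y f])
next
  case (pw_C1_step a b c)
  have "a < b" using pw_C1_step.hyps(1) by (rule pw_C1_less)
  then have "continuous_map (top_of_set {a..b}) (mtop X) \<gamma>" "continuous_map (top_of_set {b..c}) (mtop X) \<gamma>"
    using pw_C1_step.hyps(2) by (auto intro!: continuous_map_subinterval[OF pw_C1_step.prems])
  then show ?case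
    using pw_C1_step by (intro pw_C1.pw_C1_step[of Y _ a b c] C1_on_compose_map[OF X Y f]) auto
qed

lemma int_carath_contract:
  assumes X: "complex_manifold X" and f: "holomorphic_map X X f" and k: "k > 0"
    and K: "\<And>\<phi> p q. \<phi> \<in> disc_maps X \<Longrightarrow> p \<in> points X \<Longrightarrow> q \<in> points X \<Longrightarrow>
      \<phi> (f p) = 0 \<Longrightarrow> cmod (\<phi> (f q)) < k"
  shows "int_carath X (f x) (f y) \<le> ennreal k * int_carath X x y"
proof -
  have inv: "ennreal k * (ennreal (1 / k) * a) = a" "ennreal (1 / k) * (ennreal k * a) = a" for a
    using k by (simp_all flip: mult.assoc ennreal_mult)
  \<comment> \<open>The factor is moved to the left so that the infimum over paths from
    \<open>x\<close> to \<open>y\<close> stands alone on the right.\<close>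
  have "ennreal (1 / k) * int_carath X (f x) (f y) \<le> int_carath X x y"
  proof (rule int_carath_geI[OF X])
    fix \<gamma> assume "piecewise_C1_path X x y \<gamma>"
    then have c: "continuous_map (top_of_set {0..1}) (mtop X) \<gamma>" and xy: "\<gamma> 0 = x" "\<gamma> 1 = y"
      and pw: "pw_C1 X \<gamma> 0 1"
      by (simp_all add: piecewise_C1_path_iff)
    have "continuous_map (top_of_set {0..1}) (mtop X) (f \<circ> \<gamma>)"
      using f by (intro continuous_map_compose[OF c]) (simp add: holomorphic_map_def)
    then have "piecewise_C1_path X (f x) (f y) (f \<circ> \<gamma>)"
      using xy pw_C1_compose_map[OF pw X X f c] by (simp add: piecewise_C1_path_iff)
    then have "int_carath X (f x) (f y) \<le> speed_length X (f \<circ> \<gamma>) 0 1"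
      by (rule int_carath_le[OF X])
    also have "\<dots> \<le> (\<integral>\<^sup>+t. ennreal k * (carath_speed X \<gamma> t * indicator {0..1} t) \<partial>lborel)"
    proof (rule nn_integral_mono_AE)
      obtain S where S: "finite S"
        "\<And>t. t \<in> {0..1} - S \<Longrightarrow> \<exists>c d. 0 \<le> c \<and> c < t \<and> t < d \<and> d \<le> 1 \<and> C1_on X c d \<gamma>"
        using pw_C1_finite_corners[OF pw] by metis
      have "AE t in lborel. t \<notin> S"
        using S(1) by (intro AE_not_in finite_imp_null_set_lborel)
      then show "AE t in lborel. carath_speed X (f \<circ> \<gamma>) t * indicator {0..1} t
          \<le> ennreal k * (carath_speed X \<gamma> t * indicator {0..1} t)"
      proof eventually_elim
        case (elim t)
        show ?case
        proof (cases "t \<in> {0..1}")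
          case True
          then obtain a b where "0 \<le> a" "a < t" "t < b" "b \<le> 1" "C1_on X a b \<gamma>"
            using S(2)[of t] elim by blast
          then have "carath_speed X (f \<circ> \<gamma>) t \<le> ennreal k * carath_speed X \<gamma> t"
            using continuous_map_subinterval[OF c] K by (intro carath_speed_contract[OF X f k]) blast+
          then show ?thesis using True by simp
        qed simp
      qed
    qed
    also have "\<dots> \<le> ennreal k * speed_length X \<gamma> 0 1"
      using k by (rule nn_integral_cmult_le)
    finally have "ennreal (1 / k) * int_carath X (f x) (f y) \<le> ennreal (1 / k) * (ennreal k * speed_length X \<gamma> 0 1)"
      by (rule mult_left_mono) simp
    then show "ennreal (1 / k) * int_carath X (f x) (f y) \<le> speed_length X \<gamma> 0 1"
      unfolding inv .
  qed
  then have "ennreal k * (ennreal (1 / k) * int_carath X (f x) (f y)) \<le> ennreal k * int_carath X x y"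
    by (rule mult_left_mono) simp
  then show ?thesis unfolding inv .
qed

text \<open>The straight segment in the chart is lifted to \<open>X\<close>. Each of its points has
  a ball of radius \<open>r / 2\<close> inside the chart image, where every disc map is bounded by
  1, so the Cauchy estimate bounds all speeds by \<open>2 * norm w / (r / 2)\<close>, uniformly in
  the disc map.\<close>

lemma int_carath_le_chart:
  assumes X: "complex_manifold X" and U: "(U, \<kappa>) \<in> atlas X" and x: "x \<in> U" and y: "y \<in> U"
    and r: "r > 0" "ball (\<kappa> x) r \<subseteq> \<kappa> ` U" and d: "norm (\<kappa> y - \<kappa> x) < r / 2"
  shows "int_carath X x y \<le> ennreal (4 * norm (\<kappa> y - \<kappa> x) / r)"
proof -
  define w where "w = \<kappa> y - \<kappa> x"
  define l where "l = (\<lambda>t. \<kappa> x + t *\<^sub>R w)"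
  define \<gamma> where "\<gamma> = inv_into U \<kappa> \<circ> l"
  have half: "l t \<in> ball (\<kappa> x) (r / 2)" if "t \<in> {0..1}" for t
  proof -
    have "norm (t *\<^sub>R w) \<le> 1 * norm w" unfolding norm_scaleR using that by (intro mult_right_mono) auto
    then show ?thesis using d by (simp add: l_def dist_norm w_def)
  qed
  have lU: "l t \<in> \<kappa> ` U" if "t \<in> {0..1}" for t
    using half[OF that] r by (auto intro!: subsetD[OF r(2)])
  have \<kappa>\<gamma>: "\<kappa> (\<gamma> t) = l t" "\<gamma> t \<in> U" if "t \<in> {0..1}" for t
    using lU[OF that] by (simp_all add: \<gamma>_def f_inv_into_f inv_into_into)
  have ld: "(l has_vector_derivative w) (at t within S)" for t S
    unfolding l_def by (auto intro!: derivative_eq_intros)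
  then have lc: "continuous_on S l" for S
    by (auto simp: continuous_on_eq_continuous_within intro: has_vector_derivative_continuous)
  have \<gamma>c: "continuous_map (top_of_set {0..1}) (mtop X) \<gamma>"
    unfolding \<gamma>_def
    by (rule continuous_map_compose[OF _ chartD(6)[OF X U]])
      (use lc lU in \<open>auto simp: continuous_map_in_subtopology\<close>)
  have \<kappa>d: "((\<kappa> \<circ> \<gamma>) has_vector_derivative w) (at t within {0..1})" if "t \<in> {0..1}" for t
    by (rule has_vector_derivative_transform[OF that _ ld]) (simp add: \<kappa>\<gamma>)
  have C1: "C1_on X 0 1 \<gamma>"
    unfolding C1_on_def
  proof (intro ballI, clarify)
    \<comment> \<open>\<open>C1_on\<close> tests every chart of the atlas, so the transition map
      from \<open>U\<close> to \<open>V\<close> enters.\<close>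
    fix V \<psi> assume V: "(V, \<psi>) \<in> atlas X"
    let ?D = "\<lambda>s. frechet_derivative (\<psi> \<circ> inv_into U \<kappa>) (at (l s)) w"
    have "continuous_on {s \<in> {0..1}. \<gamma> s \<in> V} ?D"
    proof (rule holo_on_frechet_continuous_on)
      show "holo_on (\<psi> \<circ> inv_into U \<kappa>) (\<kappa> ` (U \<inter> V))"
        using holo_coordD(2)[OF holo_coord_chart[OF X V] U] .
      show "open (\<kappa> ` (U \<inter> V))" using chartD(4)[OF X U chartD(1)[OF X V]] .
      fix s assume "s \<in> {s \<in> {0..1}. \<gamma> s \<in> V}"
      then have "s \<in> {0..1}" "\<gamma> s \<in> V" by auto
      then show "l s \<in> \<kappa> ` (U \<inter> V)"
        using \<kappa>\<gamma>[of s] by (metis IntI imageI)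
    qed (auto intro: lc)
    moreover have "((\<psi> \<circ> \<gamma>) has_vector_derivative ?D s) (at s within {0..1})"
      if "s \<in> {0..1}" "\<gamma> s \<in> V" for s
      using chain_along_path[OF X \<gamma>c holo_coord_chart[OF X V] U that(1) _ that(2) \<kappa>d[OF that(1)]] \<kappa>\<gamma>[OF that(1)]
      by simp
    ultimately show "\<exists>D. continuous_on {s \<in> {0..1}. \<gamma> s \<in> V} D \<and>
        (\<forall>s\<in>{0..1}. \<gamma> s \<in> V \<longrightarrow> ((\<psi> \<circ> \<gamma>) has_vector_derivative D s) (at s within {0..1}))"
      by blast
  qed
  have "\<gamma> 0 = x" "\<gamma> 1 = y"
    using x y chartD(3)[OF X U] by (simp_all add: \<gamma>_def l_def w_def)
  then have "piecewise_C1_path X x y \<gamma>"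
    using \<gamma>c C1 by (auto simp: piecewise_C1_path_iff intro: pw_C1_base)
  then have "int_carath X x y \<le> speed_length X \<gamma> 0 1" by (rule int_carath_le[OF X])
  also have "\<dots> \<le> (\<integral>\<^sup>+t\<in>{0..1::real}. ennreal (4 * norm w / r) \<partial>lborel)"
  proof (rule nn_integral_mono_AE)
    have ae: "AE t in lborel. t \<notin> {0, 1::real}"
      by (intro AE_not_in finite_imp_null_set_lborel) simp
    have bound: "carath_speed X \<gamma> t \<le> ennreal (4 * norm w / r)" if t: "0 < t" "t < 1" for t
      unfolding carath_speed_def
    proof (rule SUP_least)
      fix \<phi> assume \<phi>: "\<phi> \<in> disc_maps X"
      have t': "t \<in> {0..1}" using t by simp
      have hol: "holo_coord X (points X) \<phi>" using \<phi> disc_maps_iff[OF X] by blast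
      have UX: "U \<inter> points X = U" using chartD(2)[OF X U] by blast
      have "((\<phi> \<circ> \<gamma>) has_vector_derivative frechet_derivative (\<phi> \<circ> inv_into U \<kappa>) (at (l t)) w) (at t)"
        using chain_along_path[OF X \<gamma>c hol U t' _ _ \<kappa>d[OF t']] \<kappa>\<gamma>[OF t'] chartD(2)[OF X U] t
        by (auto simp: at_within_Icc_at)
      then have "cmod (vector_derivative (\<phi> \<circ> \<gamma>) (at t)) = cmod (frechet_derivative (\<phi> \<circ> inv_into U \<kappa>) (at (l t)) w)"
        by (simp add: vector_derivative_at)
      also have "\<dots> \<le> 2 * 1 * norm w / (r / 2)"
      proof (rule Cauchy_estimate_holo)
        have sub: "ball (l t) (r / 2) \<subseteq> \<kappa> ` U"
        proof
          fix z assume "z \<in> ball (l t) (r / 2)"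
          then have "dist (\<kappa> x) z < r"
            using half[OF t'] dist_triangle[of "\<kappa> x" z "l t"] by simp
          then show "z \<in> \<kappa> ` U" using r(2) by auto
        qed
        then show "holo_on (\<phi> \<circ> inv_into U \<kappa>) (ball (l t) (r / 2))"
          using holo_coordD(2)[OF hol U] unfolding UX by (rule holo_on_subset[rotated])
        fix p assume "p \<in> ball (l t) (r / 2)"
        then have "inv_into U \<kappa> p \<in> U" using sub by (blast intro: inv_into_into)
        then show "cmod ((\<phi> \<circ> inv_into U \<kappa>) p) \<le> 1"
          using disc_mapsD[OF X \<phi>] chartD(2)[OF X U] by (force intro: less_imp_le)
      qed (use r in simp)
      finally show "ennreal (cmod (vector_derivative (\<phi> \<circ> \<gamma>) (at t))) \<le> ennreal (4 * norm w / r)"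
        by (intro ennreal_leI) simp
    qed
    from ae show "AE t in lborel. carath_speed X \<gamma> t * indicator {0..1} t \<le> ennreal (4 * norm w / r) * indicator {0..1} t"
    proof eventually_elim
      case (elim t)
      then show ?case using bound[of t] by (cases "t \<in> {0..1}") auto
    qed
  qed
  also have "\<dots> = ennreal (4 * norm w / r)"
    by (simp add: nn_integral_cmult)
  finally show ?thesis by (simp add: w_def)
qed

lemma int_carath_small_nbhd:
  assumes X: "complex_manifold X" and x: "x \<in> points X" and e: "e > 0"
  obtains N where "openin (mtop X) N" "x \<in> N" "\<And>y. y \<in> N \<Longrightarrow> int_carath X x y < ennreal e"
proof -
  obtain U \<kappa> where U: "(U, \<kappa>) \<in> atlas X" "x \<in> U" using chart_around[OF X x] .
  obtain r where r: "r > 0" "ball (\<kappa> x) r \<subseteq> \<kappa> ` U"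
    using chart_image_open[OF X U(1)] U(2) by (meson imageI openE)
  \<comment> \<open>The first bound keeps \<open>y\<close> within reach of the chart estimate; the
    second solves \<open>4 * \<delta> / r \<le> e\<close>.\<close>
  define \<delta> where "\<delta> = min (r / 2) (e * r / 4)"
  have \<delta>: "\<delta> > 0" using r(1) e by (simp add: \<delta>_def)
  define N where "N = {y \<in> U. \<kappa> y \<in> ball (\<kappa> x) \<delta>}"
  have ts: "topspace (subtopology (mtop X) U) = U"
    using openin_subset[OF chartD(1)[OF X U(1)]] by (simp add: inf.absorb2)
  have "openin (subtopology (mtop X) U) N"
    using openin_continuous_map_preimage[OF chartD(5)[OF X U(1)], of "ball (\<kappa> x) \<delta>"]
    unfolding ts N_def by simp
  then have "openin (mtop X) N"
    using chartD(1)[OF X U(1)] openin_trans_full by blast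
  moreover have "x \<in> N" using U \<delta> by (simp add: N_def)
  moreover have "int_carath X x y < ennreal e" if "y \<in> N" for y
  proof -
    have y: "y \<in> U" "norm (\<kappa> y - \<kappa> x) < r / 2" "norm (\<kappa> y - \<kappa> x) < e * r / 4"
      using that by (simp_all add: N_def \<delta>_def dist_norm norm_minus_commute)
    have "int_carath X x y \<le> ennreal (4 * norm (\<kappa> y - \<kappa> x) / r)"
      by (rule int_carath_le_chart[OF X U y(1) r y(2)])
    also have "\<dots> < ennreal e"
      using y(3) r(1) e by (simp add: ennreal_lessI field_simps)
    finally show ?thesis .
  qed
  ultimately show thesis by (rule that)
qed

section \<open>Fixed points\<close>

lemma int_carath_refl:
  assumes "complex_manifold X" "x \<in> points X"
  shows "int_carath X x x = 0"
proof -
  have "int_carath X x x \<le> 0"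
  proof (rule ennreal_le_epsilon)
    fix e :: real assume "0 < e"
    then have "int_carath X x x < ennreal e"
      using int_carath_small_nbhd[OF assms] by blast
    then show "int_carath X x x \<le> 0 + ennreal e" by simp
  qed
  then show ?thesis by simp
qed

text \<open>An infimum over no paths is infinite, so this includes the existence of piecewise smooth
  connections, although \<open>X\<close> is only assumed connected. Nearby points have finite
  distance, so finiteness of the distance from \<open>x\<close> is a locally constant property and
  holds on a clopen set containing \<open>x\<close>.\<close>

lemma int_carath_finite:
  assumes X: "complex_manifold X" and x: "x \<in> points X" and y: "y \<in> points X"
  shows "int_carath X x y < \<infinity>"
proof -
  define A where "A = {y \<in> points X. int_carath X x y < \<infinity>}"
  have nbhd: "\<exists>N. openin (mtop X) N \<and> y \<in> N \<and> (\<forall>z\<in>N. int_carath X x z < \<infinity> \<longleftrightarrow> int_carath X x y < \<infinity>)"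
    if y: "y \<in> points X" for y
  proof -
    obtain N where N: "openin (mtop X) N" "y \<in> N" "\<And>z. z \<in> N \<Longrightarrow> int_carath X y z < ennreal 1"
      using int_carath_small_nbhd[OF X y zero_less_one] by blast
    have "int_carath X x z < \<infinity> \<longleftrightarrow> int_carath X x y < \<infinity>" if "z \<in> N" for z
    proof -
      have "int_carath X y z < \<infinity>" "int_carath X z y < \<infinity>"
        using N(3)[OF that] int_carath_commute[OF X, of y z] by (auto intro: less_trans)
      then show ?thesis
        using int_carath_triangle[OF X, of x z y] int_carath_triangle[OF X, of x y z]
        by (metis ennreal_add_less_top infinity_ennreal_def le_less_trans)
    qed
    then show ?thesis using N(1,2) by blast
  qed
  have "openin (mtop X) A"
    unfolding openin_subopen[of _ A]
  proof
    fix y assume y: "y \<in> A"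
    then obtain N where "openin (mtop X) N" "y \<in> N" "\<forall>z\<in>N. int_carath X x z < \<infinity> \<longleftrightarrow> int_carath X x y < \<infinity>"
      using nbhd unfolding A_def by blast
    then show "\<exists>N. openin (mtop X) N \<and> y \<in> N \<and> N \<subseteq> A"
      using y openin_subset unfolding A_def points_def by blast
  qed
  moreover have "closedin (mtop X) A"
    unfolding closedin_def
  proof
    show "A \<subseteq> topspace (mtop X)" by (auto simp: A_def points_def)
    show "openin (mtop X) (topspace (mtop X) - A)"
      unfolding openin_subopen[of _ "topspace (mtop X) - A"]
    proof
      fix y assume y: "y \<in> topspace (mtop X) - A"
      then obtain N where "openin (mtop X) N" "y \<in> N" "\<forall>z\<in>N. int_carath X x z < \<infinity> \<longleftrightarrow> int_carath X x y < \<infinity>"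
        using nbhd unfolding points_def by blast
      then show "\<exists>N. openin (mtop X) N \<and> y \<in> N \<and> N \<subseteq> topspace (mtop X) - A"
        using y openin_subset unfolding A_def points_def by blast
    qed
  qed
  moreover have "connected_space (mtop X)" using X by (simp add: complex_manifold_def)
  moreover have "x \<in> A" using x int_carath_refl[OF X x] by (simp add: A_def)
  ultimately have "A = points X"
    unfolding connected_space_clopen_in points_def by blast
  then show ?thesis using y by (auto simp: A_def)
qed

text \<open>If the integrated distance vanishes, all disc maps agree at the two points, hence
  \<open>carath\<close> vanishes too and its separation of points applies.\<close>

lemma int_carath_hyperbolicI:
  assumes X: "complex_manifold X" and c: "is_distance_on (points X) (carath X)"
  shows "int_carath_hyperbolic X"
proof -
  have "x = y" if "x \<in> points X" "y \<in> points X" "int_carath X x y = 0" for x y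
  proof -
    have "carath X x y \<le> 0"
      unfolding carath_def
    proof (rule SUP_least)
      fix \<phi> assume "\<phi> \<in> disc_maps X"
      from disc_map_diff_le_int_carath[OF X this, of y x] that(3) have "\<phi> x = \<phi> y" by simp
      then show "ennreal (poincare_dist (\<phi> x) (\<phi> y)) \<le> 0" by (simp add: poincare_dist_def)
    qed
    then have "carath X x y = 0" by simp
    then show ?thesis using c that unfolding is_distance_on_def by blast
  qed
  then show ?thesis
    unfolding int_carath_hyperbolic_def is_distance_on_def
    using int_carath_finite[OF X] int_carath_refl[OF X] int_carath_commute[OF X] int_carath_triangle[OF X]
    by metis
qed

text \<open>Neighbourhoods are generated by subbasic sets, and the property "eventually contains
  \<open>f n\<close>" passes through finite intersections and unions.\<close>

lemma limitin_compact_open_const: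
  assumes f: "\<And>n. continuous_map S T (f n)" and c: "c \<in> topspace T"
    and unif: "\<And>V. openin T V \<Longrightarrow> c \<in> V \<Longrightarrow> \<forall>\<^sub>F n in F. \<forall>x\<in>topspace S. f n x \<in> V"
  shows "limitin (compact_open_topology S T) f (\<lambda>_. c) F"
proof -
  let ?B = "{{g. continuous_map S T g \<and> g ` K \<subseteq> V} |K V. compactin S K \<and> openin T V}"
  have "(\<lambda>_. c) \<in> {g. continuous_map S T g \<and> g ` {} \<subseteq> topspace T}"
    using c by simp
  moreover have "{g. continuous_map S T g \<and> g ` {} \<subseteq> topspace T} \<in> ?B"
    using compactin_empty openin_topspace by blast
  ultimately have "(\<lambda>_. c) \<in> topspace (compact_open_topology S T)"
    unfolding compact_open_topology_def topology_generated_by_topspace by blast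
  moreover have "\<forall>\<^sub>F n in F. f n \<in> U" if "generate_topology_on ?B U" "(\<lambda>_. c) \<in> U" for U
    using that
  proof (induction rule: generate_topology_on.induct)
    case (Int a b)
    then show ?case by (simp add: eventually_conj)
  next
    case (UN K)
    then obtain k where "k \<in> K" "(\<lambda>_. c) \<in> k" by blast
    with UN.IH[of k] show ?case by (auto elim: eventually_mono)
  next
    case (Basis s)
    then obtain K V where s: "s = {g. continuous_map S T g \<and> g ` K \<subseteq> V}" "compactin S K" "openin T V"
      by blast
    show ?case
    \<comment> \<open>For empty \<open>K\<close> the subbasic set contains the constant map even if
      \<open>c\<close> lies outside \<open>V\<close>, so \<open>unif\<close> cannot be
      invoked.\<close>
    proof (cases "K = {}")
      case True
      then show ?thesis using f s(1) by simp
    next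
      case False
      then have "c \<in> V" using Basis.prems s(1) by auto
      from unif[OF s(3) this] show ?thesis
      proof eventually_elim
        case (elim n)
        then show ?case using f s compactin_subset_topspace[OF s(2)] by auto
      qed
    qed
  qed simp
  ultimately show ?thesis
    unfolding limitin_def compact_open_topology_def openin_topology_generated_by_iff by blast
qed

lemma int_carath_hyperbolic_fixed_point:
  fixes X :: "('a, 'e::complex_finite_dim) cmanifold"
  assumes X: "complex_manifold X" and hyp: "int_carath_hyperbolic X"
    and f: "holomorphic_map X X f" and rc: "relatively_compact_in (mtop X) (f ` points X)"
  obtains c where "c \<in> points X" "f c = c" "\<And>x. x \<in> points X \<Longrightarrow> f x = x \<Longrightarrow> x = c"
    "limitin (compact_open_topology (mtop X) (mtop X)) (\<lambda>n. f ^^ n) (\<lambda>z. c) sequentially"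
proof -
  define d where "d = (\<lambda>x y. enn2real (int_carath X x y))"
  have dist: "int_carath X x y < \<infinity>" "int_carath X x y = 0 \<longleftrightarrow> x = y"
    if "x \<in> points X" "y \<in> points X" for x y
    using hyp that unfolding int_carath_hyperbolic_def is_distance_on_def by blast+
  have d: "int_carath X x y = ennreal (d x y)" if "x \<in> points X" "y \<in> points X" for x y
    using dist(1)[OF that] by (simp add: d_def)
  have d_nonneg: "d x y \<ge> 0" for x y by (simp add: d_def)
  have d_eq0: "d x y = 0 \<longleftrightarrow> x = y" if "x \<in> points X" "y \<in> points X" for x y
    using dist(2)[OF that] d[OF that] d_nonneg[of x y] by simp
  have d_comm: "d x y = d y x" for x y
    unfolding d_def using int_carath_commute[OF X] by metis
  have d_tri: "d x z \<le> d x y + d y z" if "x \<in> points X" "y \<in> points X" "z \<in> points X" for x y z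
    using int_carath_triangle[OF X, of x z y] that
    by (simp add: d d_nonneg flip: ennreal_plus)
  \<comment> \<open>The constant 2 leaves room for \<open>d x (f x)\<close>, in which both arguments
    move and \<open>f\<close> is nonexpansive.\<close>
  have cont: "continuous_map (mtop X) euclideanreal u"
    if u: "\<And>x y. x \<in> points X \<Longrightarrow> y \<in> points X \<Longrightarrow> \<bar>u x - u y\<bar> \<le> 2 * d x y" for u
    unfolding continuous_map_def
  proof (intro conjI allI impI)
    fix V :: "real set" assume V: "openin euclideanreal V"
    show "openin (mtop X) {x \<in> topspace (mtop X). u x \<in> V}"
      unfolding openin_subopen[of _ "{x \<in> topspace (mtop X). u x \<in> V}"]
    proof
      fix x assume "x \<in> {x \<in> topspace (mtop X). u x \<in> V}"
      then have x: "x \<in> points X" "u x \<in> V" by (simp_all add: points_def)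
      obtain e where e: "e > 0" "ball (u x) e \<subseteq> V"
        using V x(2) by (auto elim: openE)
      obtain N where N: "openin (mtop X) N" "x \<in> N" "\<And>y. y \<in> N \<Longrightarrow> int_carath X x y < ennreal (e / 2)"
        using int_carath_small_nbhd[OF X x(1), of "e / 2"] e(1) by auto
      have NX: "N \<subseteq> points X" using openin_subset[OF N(1)] by (simp add: points_def)
      have "u y \<in> V" if "y \<in> N" for y
      proof -
        have "d x y < e / 2"
          using N(3)[OF that] d[OF x(1), of y] NX that d_nonneg[of x y] by (auto simp: ennreal_less_iff)
        then have "dist (u x) (u y) < e"
          using u[OF x(1), of y] NX that by (auto simp: dist_real_def)
        then show ?thesis using e(2) by auto
      qed
      then show "\<exists>N. openin (mtop X) N \<and> x \<in> N \<and> N \<subseteq> {x \<in> topspace (mtop X). u x \<in> V}"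
        using N NX by (auto simp: points_def)
    qed
  qed simp
  have cont_d: "continuous_map (mtop X) euclideanreal (d a)" if a: "a \<in> points X" for a
  proof (rule cont)
    fix x y assume xy: "x \<in> points X" "y \<in> points X"
    show "\<bar>d a x - d a y\<bar> \<le> 2 * d x y"
      using d_tri[OF a xy] d_tri[OF a xy(2,1)] d_comm[of x y] d_nonneg[of x y] by simp
  qed
  have cf: "continuous_map (mtop X) (mtop X) f" using f by (simp add: holomorphic_map_def)
  have fX: "f x \<in> points X" if "x \<in> points X" for x
    using continuous_map_image_subset_topspace[OF cf] that by (auto simp: points_def)
  define K where "K = mtop X closure_of (f ` points X)"
  have K: "compactin (mtop X) K" "closedin (mtop X) K"
    using rc by (simp_all add: relatively_compact_in_def K_def)
  have KX: "K \<subseteq> points X" using compactin_subset_topspace[OF K(1)] by (simp add: points_def)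
  have fK: "f x \<in> K" if "x \<in> points X" for x
    unfolding K_def using fX that
    by (intro subsetD[OF closure_of_subset]) (auto simp: points_def)
  have "points X \<noteq> {}" using X unfolding complex_manifold_def by (rule conjunct1)
  then have Kne: "K \<noteq> {}" using fK by blast
  have compact_image: "compact (u ` L)"
    if "compactin (mtop X) L" "continuous_map (mtop X) euclideanreal u" for u L
    using image_compactin[OF that] by simp
  have bounded_on_K: "\<exists>R. \<forall>x\<in>K. d a x \<le> R" if a: "a \<in> points X" for a
  proof -
    obtain R where "\<forall>y\<in>d a ` K. norm y \<le> R"
      using compact_imp_bounded[OF compact_image[OF K(1) cont_d[OF a]]] unfolding bounded_iff by blast
    then show ?thesis by (intro exI[of _ R]) (simp add: d_nonneg)
  qed
  obtain a where a: "a \<in> K" using Kne by blast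
  obtain R where R: "\<And>x. x \<in> K \<Longrightarrow> d a x \<le> R" using bounded_on_K a KX by blast
  have "R \<ge> 0" using R[OF a] d_nonneg[of a a] by linarith
  \<comment> \<open>Two points of \<open>K\<close> have distance at most \<open>2 * R\<close>. If
    \<phi> vanishes at the first, half of \<open>- ln (1 - (cmod z)\<^sup>2)\<close>, for its value
    \<open>z\<close> at the second, is at most \<open>2 * R\<close>. Solving for the modulus gives
    the square root; the extra 1 makes the bound strict and \<open>k\<close> positive even for
    \<open>R = 0\<close>.\<close>
  define k where "k = sqrt (1 - exp (- (4 * R + 1)))"
  have "exp (- (4 * R + 1)) < 1" using \<open>R \<ge> 0\<close> by simp
  then have k: "0 < k" "k < 1" by (simp_all add: k_def)
  have "cmod (\<phi> (f q)) < k"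
    if \<phi>: "\<phi> \<in> disc_maps X" and pq: "p \<in> points X" "q \<in> points X" and 0: "\<phi> (f p) = 0" for \<phi> p q
  proof -
    have "d (f p) (f q) \<le> 2 * R"
      using d_tri[OF fX[OF pq(1)] _ fX[OF pq(2)], of a] a KX R[OF fK[OF pq(1)]] R[OF fK[OF pq(2)]]
        d_comm[of a "f p"] by auto
    moreover have "\<bar>ln (1 - (cmod (\<phi> (f p)))\<^sup>2) - ln (1 - (cmod (\<phi> (f q)))\<^sup>2)\<bar> / 2 \<le> d (f p) (f q)"
      using disc_map_ln_diff_le_int_carath[OF X \<phi>, of "f p" "f q"] d[OF fX[OF pq(1)] fX[OF pq(2)]]
        d_nonneg[of "f p" "f q"] by simp
    ultimately have ln: "- (4 * R + 1) < ln (1 - (cmod (\<phi> (f q)))\<^sup>2)" using 0 by simp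
    have "(cmod (\<phi> (f q)))\<^sup>2 < 1"
      using disc_mapsD[OF X \<phi> fX[OF pq(2)]] by (simp add: abs_square_less_1)
    then have "exp (ln (1 - (cmod (\<phi> (f q)))\<^sup>2)) = 1 - (cmod (\<phi> (f q)))\<^sup>2" by simp
    with ln have "exp (- (4 * R + 1)) < 1 - (cmod (\<phi> (f q)))\<^sup>2"
      by (metis exp_less_mono)
    then show ?thesis unfolding k_def by (intro real_less_rsqrt) simp
  qed
  then have contract_int: "int_carath X (f x) (f y) \<le> ennreal k * int_carath X x y" for x y
    by (rule int_carath_contract[OF X f k(1)])
  have contract: "d (f x) (f y) \<le> k * d x y" if xy: "x \<in> points X" "y \<in> points X" for x y
  proof -
    have "ennreal (d (f x) (f y)) \<le> ennreal k * ennreal (d x y)"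
      using contract_int[of x y] unfolding d[OF xy] d[OF fX[OF xy(1)] fX[OF xy(2)]] .
    also have "\<dots> = ennreal (k * d x y)"
      using k(1) d_nonneg by (simp add: ennreal_mult)
    finally show ?thesis
      using k(1) d_nonneg[of x y] by (simp add: ennreal_le_iff)
  qed
  define g where "g = (\<lambda>x. d x (f x))"
  have "continuous_map (mtop X) euclideanreal g"
  proof (rule cont)
    fix x y assume xy: "x \<in> points X" "y \<in> points X"
    have "d (f x) (f y) \<le> d x y"
      using contract[OF xy] k d_nonneg[of x y] mult_left_le_one_le[of "d x y" k] by simp
    then show "\<bar>g x - g y\<bar> \<le> 2 * d x y"
      using d_tri[of x y "f x"] d_tri[of y "f y" "f x"] d_tri[of y x "f y"] d_tri[of x "f x" "f y"]
        xy fX d_comm[of x y] d_comm[of "f x" "f y"] by (simp add: g_def)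
  qed
  then obtain c where c: "c \<in> K" "\<And>x. x \<in> K \<Longrightarrow> g c \<le> g x"
    using compact_attains_inf[OF compact_image[OF K(1)], of g] Kne by auto
  have cX: "c \<in> points X" using c(1) KX by blast
  \<comment> \<open>\<open>f c\<close> lies in \<open>K\<close> again, so minimality gives
    \<open>g c \<le> g (f c)\<close>, while contraction gives
    \<open>g (f c) \<le> k * g c\<close>.\<close>
  have fc: "f c = c"
  proof (rule ccontr)
    assume "f c \<noteq> c"
    then have "g c > 0" using d_eq0[OF cX fX[OF cX]] d_nonneg[of c "f c"] by (auto simp: g_def)
    moreover have "g c \<le> k * g c"
      using c(2)[OF fK[OF cX]] contract[OF cX fX[OF cX]] by (simp add: g_def)
    ultimately show False using k by simp
  qed
  have unique: "x = c" if x: "x \<in> points X" "f x = x" for x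
  proof (rule ccontr)
    assume "x \<noteq> c"
    then have "d x c > 0" using d_eq0[OF x(1) cX] d_nonneg[of x c] by auto
    moreover have "d x c \<le> k * d x c" using contract[OF x(1) cX] x(2) fc by simp
    ultimately show False using k by simp
  qed
  have iter: "(f ^^ n) x \<in> points X \<and> d c ((f ^^ n) x) \<le> k ^ n * d c x" if x: "x \<in> points X" for n x
  proof (induction n)
    case (Suc n)
    have "d c ((f ^^ Suc n) x) \<le> k * d c ((f ^^ n) x)"
      using contract[OF cX, of "(f ^^ n) x"] Suc fc by simp
    also have "\<dots> \<le> k * (k ^ n * d c x)"
      using Suc k by (intro mult_left_mono) auto
    finally show ?case using Suc fX by simp
  qed (use x in simp)
  obtain R' where R': "\<And>x. x \<in> K \<Longrightarrow> d c x \<le> R'" using bounded_on_K[OF cX] by blast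
  have unif: "\<forall>\<^sub>F n in sequentially. \<forall>x\<in>topspace (mtop X). (f ^^ n) x \<in> V"
    if V: "openin (mtop X) V" "c \<in> V" for V
  proof -
    have in_K: "(f ^^ Suc n) x \<in> K" if "x \<in> points X" for n x
      using fK iter[OF that, of n] by simp
    \<comment> \<open>One application of \<open>f\<close> is spent on moving all of \<open>X\<close>
      into \<open>K\<close>, where \<open>d c\<close> is bounded by \<open>R'\<close>; this makes
      the rate uniform although \<open>d c\<close> may be unbounded on \<open>X\<close>.\<close>
    have "\<forall>\<^sub>F n in sequentially. \<forall>x\<in>points X. (f ^^ Suc n) x \<in> V"
    proof (cases "K - V = {}")
      case True
      then show ?thesis using in_K by (intro always_eventually) blast
    next
      case False
      have "K - V = K \<inter> (topspace (mtop X) - V)"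
        using KX by (auto simp: points_def)
      then have "compactin (mtop X) (K - V)"
        using V(1) K by (auto intro: closed_compactin[of _ K])
      \<comment> \<open>The minimum of \<open>d c\<close> over the compact set \<open>K - V\<close>
        is positive by separation of points; any point of \<open>K\<close> closer to
        \<open>c\<close> than that lies in \<open>V\<close>.\<close>
      then obtain b where b: "b \<in> K - V" "\<And>x. x \<in> K - V \<Longrightarrow> d c b \<le> d c x"
        using compact_attains_inf[OF compact_image[OF _ cont_d[OF cX]], of "K - V"] False by auto
      then have "d c b > 0"
        using d_eq0[OF cX, of b] d_nonneg[of c b] KX V(2) by force
      moreover have "(\<lambda>n. k ^ n * R') \<longlonglongrightarrow> 0"
        using k by (intro tendsto_mult_left_zero LIMSEQ_power_zero) simp
      ultimately have "\<forall>\<^sub>F n in sequentially. k ^ n * R' < d c b"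
        by (rule order_tendstoD(2)[rotated])
      then show ?thesis
      proof eventually_elim
        case (elim n)
        show ?case
        proof (rule ballI, rule ccontr)
          fix x assume x: "x \<in> points X" "(f ^^ Suc n) x \<notin> V"
          have "d c b \<le> d c ((f ^^ Suc n) x)" using b(2) in_K[OF x(1)] x(2) by blast
          also have "\<dots> = d c ((f ^^ n) (f x))" by (simp add: funpow_swap1)
          also have "\<dots> \<le> k ^ n * d c (f x)" using iter[OF fX[OF x(1)], of n] by blast
          also have "\<dots> \<le> k ^ n * R'" using R'[OF fK[OF x(1)]] k by (intro mult_left_mono) auto
          finally show False using elim by simp
        qed
      qed
    qed
    then show ?thesis
      using eventually_sequentially_Suc[of "\<lambda>n. \<forall>x\<in>points X. (f ^^ n) x \<in> V"] by (simp add: points_def)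
  qed
  have "continuous_map (mtop X) (mtop X) (f ^^ n)" for n
  proof (induction n)
    case (Suc n)
    show ?case unfolding funpow.simps using Suc cf by (rule continuous_map_compose)
  qed (simp add: id_def)
  then have "limitin (compact_open_topology (mtop X) (mtop X)) (\<lambda>n. f ^^ n) (\<lambda>z. c) sequentially"
    using cX unif by (intro limitin_compact_open_const) (simp_all add: points_def)
  with cX fc unique show thesis by (rule that)
qed

theorem theorem2:
  fixes X :: "('a, 'e::complex_finite_dim) cmanifold"
    and f :: "'a \<Rightarrow> 'a"
  assumes "complex_manifold X"
  shows "(int_carath_hyperbolic X \<and> holomorphic_map X X f \<and>
            relatively_compact_in (mtop X) (f ` points X) \<longrightarrow>
          (\<exists>c\<in>points X. f c = c \<and> (\<forall>x\<in>points X. f x = x \<longrightarrow> x = c) \<and>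
             limitin (compact_open_topology (mtop X) (mtop X)) (\<lambda>n. f ^^ n) (\<lambda>z. c) sequentially))
       \<and> (is_distance_on (points X) (carath X) \<longrightarrow> int_carath_hyperbolic X)"
proof (intro conjI impI)
  assume "int_carath_hyperbolic X \<and> holomorphic_map X X f \<and>
    relatively_compact_in (mtop X) (f ` points X)"
  then obtain c where "c \<in> points X" "f c = c" "\<And>x. x \<in> points X \<Longrightarrow> f x = x \<Longrightarrow> x = c"
    "limitin (compact_open_topology (mtop X) (mtop X)) (\<lambda>n. f ^^ n) (\<lambda>z. c) sequentially"
    using int_carath_hyperbolic_fixed_point[OF assms] by metis
  then show "\<exists>c\<in>points X. f c = c \<and> (\<forall>x\<in>points X. f x = x \<longrightarrow> x = c) \<and>
      limitin (compact_open_topology (mtop X) (mtop X)) (\<lambda>n. f ^^ n) (\<lambda>z. c) sequentially"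
    by blast
next
  assume "is_distance_on (points X) (carath X)"
  with assms show "int_carath_hyperbolic X" by (rule int_carath_hyperbolicI)
qed

end
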